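(* Let $\gamma\in[0,\frac12]$, $\mu\ge0$, $Q\in\mathcal{L}(H_\gamma,Y)$. Let $M,m$ be positive continuous functions on $[0,\infty)$, each bounded below by a positive constant, and let $e(\lambda)$ be a nonnegative function. Assume there are $N>0$ and $\lambda_0\ge0$ such that for all $\lambda>\lambda_0$, $$\|u\|_H\le M(\lambda)\lambda^{-1}\|(P-\lambda^2)\Lambda^{\mu-\gamma}u\|_H+m(\lambda)\|Q\Lambda^\mu u\|_Y+e(\lambda)\|\Lambda^{-N}u\|_H$$ uniformly for all $u\in H_{1+\mu-\gamma}$. Fix a positive $\alpha\ge2\gamma$. Then there exist $C,\lambda_0'>0$ such that for all $\lambda>\lambda_0'$, $$\|u\|_H\le C\left(M(\lambda^{\frac1\alpha})\lambda^{\frac1\alpha-1}+m(\lambda^{\frac1\alpha})\lambda^{1+(-2+2(2\gamma+1-\alpha)_+)/\alpha}\right)\langle\lambda\rangle^{-1}\|(P^\alpha-\lambda^2)\Lambda_{(\alpha)}^{(\mu-\gamma)/\alpha}u\|_H+Cm(\lambda^{\frac1\alpha})\|Q\Lambda_{(\alpha)}^{\mu/\alpha}u\|_Y+Ce(\lambda^{\frac1\alpha})\|\Lambda_{(\alpha)}^{-N/\alpha}u\|_H$$ uniformly for all $u\in H^{(\alpha)}_{1+(\mu-\gamma)/\alpha}$, where $(x)_+=\max\{x,0\}$. (That is, the control estimate holds for $P^\alpha$ and $Q\in\mathcal{L}(H^{(\alpha)}_{\gamma/\alpha},Y)$.)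
   Context: Let $H=H_0$ be a Hilbert space and let $P$ be a nonnegative self-adjoint operator on $H$ with compact resolvent, defined on a dense subspace $H_1\subset H$. Write its spectral resolution as $P=\int_0^\infty\rho^2\,dE_\rho$. For $s\in\mathbb{R}$ put $\Lambda^s=\int_0^\infty(1+\rho^2)^s\,dE_\rho$ and $H_s=\Lambda^{-s}(H)$ with norm $\|u\|_s=\|\Lambda^su\|_H$. For $\alpha>0$ put $P^\alpha=\int_0^\infty\rho^{2\alpha}\,dE_\rho$, $\Lambda_{(\alpha)}^s=\int_0^\infty(1+\rho^{2\alpha})^s\,dE_\rho$ and $H_s^{(\alpha)}=\Lambda_{(\alpha)}^{-s}(H)$. $Y$ is a Hilbert space. Notation: $\langle\lambda\rangle=(1+\lambda^2)^{1/2}$. *)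

theory Defs
  imports "HOL-Analysis.Analysis"
begin

text \<open>
  Hilbert spaces are types of sort \<open>{real_inner, complete_space}\<close>. A complex Hilbert space is
  one of these with \<open>x \<bullet> y\<close> the real part of its inner product. All hypotheses below
  (self-adjointness, nonnegativity, compact resolvent, orthogonal projections, boundedness) hold
  for the underlying real space when they hold for the complex one, and only norms and real
  scalars occur in the estimates, so both real and complex scalars are covered.

  An unbounded operator is a total function together with an explicit domain; its values off the
  domain are irrelevant.
\<close>

definition linear_op_on :: "'a::real_vector set \<Rightarrow> ('a \<Rightarrow> 'b::real_vector) \<Rightarrow> bool" where
  "linear_op_on D T \<longleftrightarrow> subspace D \<and>
     (\<forall>u\<in>D. \<forall>v\<in>D. T (u + v) = T u + T v) \<and> (\<forall>c. \<forall>u\<in>D. T (c *\<^sub>R u) = c *\<^sub>R T u)"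

text \<open>The last conjunct says that the graph of the adjoint equals the graph of \<open>P\<close>.\<close>

definition self_adjoint_on :: "'h::real_inner set \<Rightarrow> ('h \<Rightarrow> 'h) \<Rightarrow> bool" where
  "self_adjoint_on D P \<longleftrightarrow> linear_op_on D P \<and> closure D = UNIV \<and>
     (\<forall>v w. (\<forall>u\<in>D. P u \<bullet> v = u \<bullet> w) \<longleftrightarrow> (v \<in> D \<and> w = P v))"

definition nonneg_on :: "'h::real_inner set \<Rightarrow> ('h \<Rightarrow> 'h) \<Rightarrow> bool" where
  "nonneg_on D P \<longleftrightarrow> (\<forall>u\<in>D. 0 \<le> P u \<bullet> u)"

text \<open>
  The inverse of \<open>P - z\<close> maps bounded sets to relatively compact ones (hence it is bounded) for
  some \<open>z\<close>, equivalently for every \<open>z\<close> in the resolvent set.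
\<close>

definition compact_resolvent_on :: "'h::real_inner set \<Rightarrow> ('h \<Rightarrow> 'h) \<Rightarrow> bool" where
  "compact_resolvent_on D P \<longleftrightarrow> (\<exists>z::real.
     bij_betw (\<lambda>u. P u - z *\<^sub>R u) D UNIV \<and>
     (\<forall>B. bounded B \<longrightarrow> compact (closure (inv_into D (\<lambda>u. P u - z *\<^sub>R u) ` B))))"

definition orth_projection :: "('h::real_inner \<Rightarrow> 'h) \<Rightarrow> bool" where
  "orth_projection p \<longleftrightarrow> linear p \<and> (\<forall>u. p (p u) = p u) \<and> (\<forall>u v. p u \<bullet> v = u \<bullet> p v)"

definition spectral_family :: "(real \<Rightarrow> 'h::real_inner \<Rightarrow> 'h) \<Rightarrow> bool" where
  "spectral_family E \<longleftrightarrow>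
     (\<forall>r. orth_projection (E r)) \<and>
     (\<forall>r s u. r \<le> s \<longrightarrow> E r (E s u) = E r u \<and> E s (E r u) = E r u) \<and>
     (\<forall>r u. ((\<lambda>s. E s u) \<longlongrightarrow> E r u) (at_right r)) \<and>
     (\<forall>u. ((\<lambda>r. E r u) \<longlongrightarrow> 0) at_bot) \<and>
     (\<forall>u. ((\<lambda>r. E r u) \<longlongrightarrow> u) at_top)"

text \<open>
  The operator \<open>\<integral> f dE\<close> is obtained from step functions by \<open>L\<^sup>2\<close> closure. A step function is a list
  of triples \<open>(c, a, b)\<close> with \<open>a \<le> b\<close>, standing for the sum of the functions \<open>c\<close> times the indicator
  of the half-open interval from \<open>a\<close> (excluded) to \<open>b\<close> (included); the intervals may overlap. The
  measure \<open>d\<parallel>E\<^sub>r u\<parallel>\<^sup>2\<close> is the Stieltjes measure of \<open>r \<mapsto> \<parallel>E\<^sub>r u\<parallel>\<^sup>2 = \<langle>E\<^sub>r u, u\<rangle>\<close>.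
\<close>

definition spectral_measure :: "(real \<Rightarrow> 'h::real_inner \<Rightarrow> 'h) \<Rightarrow> 'h \<Rightarrow> real measure" where
  "spectral_measure E u = interval_measure (\<lambda>r. (norm (E r u))\<^sup>2)"

definition is_step :: "(real \<times> real \<times> real) list \<Rightarrow> bool" where
  "is_step S \<longleftrightarrow> (\<forall>(c, a, b) \<in> set S. a \<le> b)"

definition step_fun :: "(real \<times> real \<times> real) list \<Rightarrow> real \<Rightarrow> real" where
  "step_fun S r = (\<Sum>(c, a, b)\<leftarrow>S. c * indicator {a<..b} r)"

definition step_op ::
  "(real \<Rightarrow> 'h::real_inner \<Rightarrow> 'h) \<Rightarrow> (real \<times> real \<times> real) list \<Rightarrow> 'h \<Rightarrow> 'h" where
  "step_op E S u = (\<Sum>(c, a, b)\<leftarrow>S. c *\<^sub>R (E b u - E a u))"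

definition has_spectral_integral ::
  "(real \<Rightarrow> 'h::real_inner \<Rightarrow> 'h) \<Rightarrow> (real \<Rightarrow> real) \<Rightarrow> 'h \<Rightarrow> 'h \<Rightarrow> bool" where
  "has_spectral_integral E f u w \<longleftrightarrow> f \<in> borel_measurable borel \<and>
     (\<exists>S. (\<forall>n::nat. is_step (S n)) \<and>
        (\<lambda>n. \<integral>\<^sup>+ r. ennreal ((f r - step_fun (S n) r)\<^sup>2) \<partial>spectral_measure E u) \<longlonglongrightarrow> 0 \<and>
        (\<lambda>n. step_op E (S n) u) \<longlonglongrightarrow> w)"

definition spectral_dom ::
  "(real \<Rightarrow> 'h::real_inner \<Rightarrow> 'h) \<Rightarrow> (real \<Rightarrow> real) \<Rightarrow> 'h set" where
  "spectral_dom E f = {u. integrable (spectral_measure E u) (\<lambda>r. (f r)\<^sup>2)}"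

definition spectral_op ::
  "(real \<Rightarrow> 'h::real_inner \<Rightarrow> 'h) \<Rightarrow> (real \<Rightarrow> real) \<Rightarrow> 'h \<Rightarrow> 'h" where
  "spectral_op E f u = (THE w. has_spectral_integral E f u w)"

text \<open>
  \<open>P = \<integral> r\<^sup>2 dE\<^sub>r\<close> over \<open>r \<ge> 0\<close>, as an equality of unbounded operators (domains included). Since
  \<open>E r = 0\<close> for \<open>r < 0\<close>, all spectral measures live on \<open>r \<ge> 0\<close> (with a possible atom at \<open>0\<close>, the kernel
  of \<open>P\<close>), so the values of integrands at negative \<open>r\<close> play no role anywhere below.
\<close>

definition spectral_resolution ::
  "'h::real_inner set \<Rightarrow> ('h \<Rightarrow> 'h) \<Rightarrow> (real \<Rightarrow> 'h \<Rightarrow> 'h) \<Rightarrow> bool" where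
  "spectral_resolution D P E \<longleftrightarrow> spectral_family E \<and> (\<forall>r<0. \<forall>u. E r u = 0) \<and>
     D = spectral_dom E (\<lambda>r. r\<^sup>2) \<and> (\<forall>u\<in>D. P u = spectral_op E (\<lambda>r. r\<^sup>2) u)"

definition Lam :: "(real \<Rightarrow> 'h::real_inner \<Rightarrow> 'h) \<Rightarrow> real \<Rightarrow> 'h \<Rightarrow> 'h" where
  "Lam E s = spectral_op E (\<lambda>r. (1 + r\<^sup>2) powr s)"

definition P_pow :: "(real \<Rightarrow> 'h::real_inner \<Rightarrow> 'h) \<Rightarrow> real \<Rightarrow> 'h \<Rightarrow> 'h" where
  "P_pow E \<alpha> = spectral_op E (\<lambda>r. r powr (2 * \<alpha>))"

definition Lam_pow :: "(real \<Rightarrow> 'h::real_inner \<Rightarrow> 'h) \<Rightarrow> real \<Rightarrow> real \<Rightarrow> 'h \<Rightarrow> 'h" where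
  "Lam_pow E \<alpha> s = spectral_op E (\<lambda>r. (1 + r powr (2 * \<alpha>)) powr s)"

text \<open>
  The spaces \<open>H\<^sub>s = \<Lambda>\<^sup>-\<^sup>s(H)\<close> and their analogues for \<open>P\<^sup>\<alpha>\<close>. These definitions are meant for
  \<open>s \<ge> 0\<close>, where \<open>\<Lambda>\<^sup>-\<^sup>s\<close> is bounded and everywhere defined and \<open>H\<^sub>s\<close> is a subspace of \<open>H\<close>; for \<open>s < 0\<close>
  one would need a completion of \<open>H\<close>.
\<close>

definition Hs :: "(real \<Rightarrow> 'h::real_inner \<Rightarrow> 'h) \<Rightarrow> real \<Rightarrow> 'h set" where
  "Hs E s = range (Lam E (- s))"

definition Hs_pow :: "(real \<Rightarrow> 'h::real_inner \<Rightarrow> 'h) \<Rightarrow> real \<Rightarrow> real \<Rightarrow> 'h set" where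
  "Hs_pow E \<alpha> s = range (Lam_pow E \<alpha> (- s))"

definition bounded_op_on ::
  "'h::real_vector set \<Rightarrow> ('h \<Rightarrow> real) \<Rightarrow> ('h \<Rightarrow> 'y::real_normed_vector) \<Rightarrow> bool" where
  "bounded_op_on X nrm Q \<longleftrightarrow> linear_op_on X Q \<and> (\<exists>K. \<forall>u\<in>X. norm (Q u) \<le> K * nrm u)"

definition jap :: "real \<Rightarrow> real" where
  "jap x = sqrt (1 + x\<^sup>2)"

end

theory Submission
  imports Defs "HOL-Probability.Distribution_Functions"
begin

text \<open>
  Put \<open>\<tau> = \<lambda>\<^sup>1\<^sup>/\<^sup>\<alpha>\<close> and split \<open>u\<close> at the frequency \<open>2\<tau>\<close>. On \<open>r \<le> 2\<tau>\<close> the symbol \<open>r\<^sup>2 - \<tau>\<^sup>2\<close> is bounded by a constant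
  times \<open>\<tau>\<^sup>2\<^sup>-\<^sup>2\<^sup>\<alpha> (r\<^sup>2\<^sup>\<alpha> - \<lambda>\<^sup>2)\<close>, so there the hypothesis at frequency \<open>\<tau>\<close> gives the estimate for \<open>P\<^sup>\<alpha>\<close>. On
  \<open>r > 2\<tau>\<close> the operator \<open>P\<^sup>\<alpha> - \<lambda>\<^sup>2\<close> is elliptic; this part of \<open>u\<close>, and the error it causes in the observation
  \<open>Q \<Lambda>\<^sup>\<mu>\<close>, are bounded by \<open>\<tau>\<^sup>4\<^sup>\<gamma>\<^sup>-\<^sup>2\<^sup>\<alpha>\<close> times the norm of \<open>(P\<^sup>\<alpha> - \<lambda>\<^sup>2) \<Lambda>\<^sub>(\<^sub>\<alpha>\<^sub>)\<^sup>(\<^sup>\<mu>\<^sup>-\<^sup>\<gamma>\<^sup>)\<^sup>/\<^sup>\<alpha> u\<close>. Since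
  \<open>4\<gamma> - 2\<alpha> \<le> -2 + 2 max(2\<gamma> + 1 - \<alpha>, 0)\<close>, this is the second term of the coefficient.
\<close>

section \<open>Functional calculus of a spectral family\<close>

text \<open>The obstacle is the observation. The brackets of \<open>P\<close> and of its power are
  comparable, which suffices for every other norm, but \<open>Q\<close> does not respect pointwise
  bounds between multipliers. The test vector must therefore reproduce the low frequencies of the
  observed vector exactly, not merely up to constants. The power of \<open>\<tau>\<close> is a
  balance of weights. Ellipticity gains one full bracket \<open>1 + r powr (2 * \<alpha>)\<close>;
  observing through \<open>Q\<close> costs \<open>\<gamma> / \<alpha>\<close> powers of it, and the
  weight \<open>(\<mu> - \<gamma>) / \<alpha>\<close> of the residual lacks as many again. The net
  exponent \<open>2 * \<gamma> / \<alpha> - 1\<close> is nonpositive exactly when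
  \<open>2 * \<gamma> \<le> \<alpha>\<close>, and then the bracket, which exceeds
  \<open>\<tau> powr (2 * \<alpha>)\<close>, may be traded for that power of \<open>\<tau>\<close>.
  The cut is at \<open>2 * \<tau>\<close> rather than \<open>\<tau>\<close> because
  \<open>r = \<tau>\<close> is a zero of both symbols: it must stay at a proportional distance from
  the elliptic region, while \<open>r / \<tau>\<close> stays in a fixed bounded range below the
  cut.\<close>

lemma step_fun_Nil [simp]: "step_fun [] r = 0"
  and step_fun_Cons: "step_fun ((c, a, b) # S) r = c * indicator {a<..b} r + step_fun S r"
  and step_fun_append: "step_fun (S @ T) r = step_fun S r + step_fun T r"
  by (simp_all add: step_fun_def)

lemma step_op_Nil [simp]: "step_op E [] u = 0"
  and step_op_Cons: "step_op E ((c, a, b) # S) u = c *\<^sub>R (E b u - E a u) + step_op E S u"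
  and step_op_append: "step_op E (S @ T) u = step_op E S u + step_op E T u"
  by (simp_all add: step_op_def)

lemma is_step_Nil [simp]: "is_step []"
  and is_step_Cons [simp]: "is_step ((c, a, b) # S) \<longleftrightarrow> a \<le> b \<and> is_step S"
  and is_step_append [simp]: "is_step (S @ T) \<longleftrightarrow> is_step S \<and> is_step T"
  by (simp_all only: is_step_def set_append ball_Un) simp_all

lemma step_fun_measurable [measurable]: "step_fun S \<in> borel_measurable borel"
proof (induction S)
  case Nil
  show ?case by (simp add: step_fun_def[abs_def])
next
  case (Cons t S)
  obtain c a b where "t = (c, a, b)" by (cases t)
  with Cons show ?case by (simp add: step_fun_Cons[abs_def])
qed

definition step_scale :: "real \<Rightarrow> (real \<times> real \<times> real) list \<Rightarrow> (real \<times> real \<times> real) list" where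
  "step_scale k S = map (\<lambda>(c, a, b). (k * c, a, b)) S"

lemma step_fun_scale: "step_fun (step_scale k S) r = k * step_fun S r"
  by (induction S) (auto simp: step_scale_def step_fun_Cons algebra_simps)

lemma step_op_scale: "step_op E (step_scale k S) u = k *\<^sub>R step_op E S u"
  by (induction S) (auto simp: step_scale_def step_op_Cons algebra_simps)

lemma is_step_scale: "is_step S \<Longrightarrow> is_step (step_scale k S)"
  by (induction S) (auto simp: step_scale_def)

text \<open>Clipping both endpoints is the list form of applying \<open>E t\<close>, because
  \<open>E t (E b u)\<close> is \<open>E (min b t) u\<close>. Intervals beyond \<open>t\<close>
  collapse to empty ones and stay in the list, so nothing has to be filtered.\<close>

definition step_cut :: "real \<Rightarrow> (real \<times> real \<times> real) list \<Rightarrow> (real \<times> real \<times> real) list" where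
  "step_cut t S = map (\<lambda>(c, a, b). (c, min a t, min b t)) S"

lemma step_fun_cut: "step_fun (step_cut t S) r = indicator {..t} r * step_fun S r"
  by (induction S) (auto simp: step_cut_def step_fun_Cons algebra_simps indicator_def)

lemma is_step_cut: "is_step S \<Longrightarrow> is_step (step_cut t S)"
  by (induction S) (auto simp: step_cut_def)

section \<open>Spectral measures and the isometry for step functions\<close>

locale half_line_spectral_family =
  fixes E :: "real \<Rightarrow> 'h::{real_inner, complete_space} \<Rightarrow> 'h"
  assumes spectral_family: "spectral_family E"
    and E_neg: "r < 0 \<Longrightarrow> E r u = 0"
begin

text \<open>In this context \<open>\<mu>\<close> names the spectral measure; the exponent called
  \<open>\<mu>\<close> in the theorem is \<open>\<nu>\<close> here.\<close>

abbreviation \<mu> :: "'h \<Rightarrow> real measure" where "\<mu> \<equiv> spectral_measure E"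
abbreviation hsi where "hsi \<equiv> has_spectral_integral E"

lemma linear_E: "linear (E r)"
  and E_idem: "E r (E r u) = E r u"
  and E_symmetric: "E r u \<bullet> v = u \<bullet> E r v"
  using spectral_family unfolding spectral_family_def orth_projection_def by blast+

lemma E_E: "E r (E s u) = E (min r s) u"
  using spectral_family unfolding spectral_family_def by (metis linorder_le_cases min_absorb1 min_absorb2)

lemma E_inner: "E r u \<bullet> E s u = (norm (E (min r s) u))\<^sup>2"
  by (metis E_E E_idem E_symmetric min.commute power2_norm_eq_inner)

lemma norm_E_le: "norm (E r u) \<le> norm u"
proof -
  have "(norm (E r u))\<^sup>2 = u \<bullet> E r u"
    by (metis E_idem E_symmetric power2_norm_eq_inner)
  also have "\<dots> \<le> norm u * norm (E r u)"
    by (rule norm_cauchy_schwarz)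
  finally show ?thesis
    by (cases "E r u = 0") (simp_all add: power2_eq_square)
qed

lemma bounded_linear_E: "bounded_linear (E r)"
  using linear_E norm_E_le by (auto simp: bounded_linear_def bounded_linear_axioms_def intro!: exI[of _ 1])

lemma E_mono: "r \<le> s \<Longrightarrow> (norm (E r u))\<^sup>2 \<le> (norm (E s u))\<^sup>2"
  using norm_E_le[of r "E s u"] by (simp add: E_E min_absorb1)

lemma E_right_cont: "continuous (at_right a) (\<lambda>r. (norm (E r u))\<^sup>2)"
  using spectral_family unfolding spectral_family_def continuous_within
  by (auto intro!: tendsto_intros)

lemma E_at_bot: "((\<lambda>r. E r u) \<longlongrightarrow> 0) at_bot"
  and E_at_top: "((\<lambda>r. E r u) \<longlongrightarrow> u) at_top"
  using spectral_family unfolding spectral_family_def by auto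

lemma norm_E_at_bot: "((\<lambda>r. (norm (E r u))\<^sup>2) \<longlongrightarrow> 0) at_bot"
  and norm_E_at_top: "((\<lambda>r. (norm (E r u))\<^sup>2) \<longlongrightarrow> (norm u)\<^sup>2) at_top"
  using tendsto_power[OF tendsto_norm[OF E_at_bot], of u 2]
    tendsto_power[OF tendsto_norm[OF E_at_top], of u 2] by auto

lemma finite_borel_measure_mu: "finite_borel_measure (\<mu> u)"
  unfolding spectral_measure_def
  by (rule finite_borel_measure_interval_measure[OF E_mono E_right_cont norm_E_at_bot norm_E_at_top]) auto

lemma finite_mu: "finite_measure (\<mu> u)"
  using finite_borel_measure_mu finite_borel_measure_def by blast

lemma sets_mu [simp, measurable_cong]: "sets (\<mu> u) = sets borel"
  by (simp add: spectral_measure_def)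

lemma space_mu [simp]: "space (\<mu> u) = UNIV"
  by (simp add: spectral_measure_def)

lemma measurable_mu [simp]: "borel_measurable (\<mu> u) = borel_measurable borel"
  by (rule measurable_cong_sets) simp_all

lemma measure_mu_Iic: "measure (\<mu> u) {..x} = (norm (E x u))\<^sup>2"
  unfolding spectral_measure_def
  by (rule measure_interval_measure_Iic[OF E_mono E_right_cont norm_E_at_bot]) auto

lemma emeasure_mu_Iic: "emeasure (\<mu> u) {..x} = ennreal ((norm (E x u))\<^sup>2)"
  by (metis finite_measure.emeasure_eq_measure finite_mu measure_mu_Iic)

text \<open>The negative half line is a countable union of half lines on which \<open>E\<close>
  vanishes. The point 0 may carry an atom and is kept. Multiplier inequalities thus need checking
  only for \<open>r \<ge> 0\<close>.\<close>

lemma AE_mu_nonneg: "AE r in \<mu> u. 0 \<le> r"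
proof -
  have "AE r in \<mu> u. \<forall>n::nat. r \<notin> {..- 1 / (real n + 1)}"
    unfolding AE_all_countable
    by (intro allI AE_not_in) (auto simp: null_sets_def emeasure_mu_Iic E_neg)
  then show ?thesis
  proof eventually_elim
    case (elim r)
    show ?case
    proof (rule ccontr)
      assume "\<not> 0 \<le> r"
      then obtain n :: nat where "inverse (real (Suc n)) < - r"
        using reals_Archimedean[of "- r"] by auto
      then have "r \<le> - 1 / (real n + 1)"
        by (simp add: inverse_eq_divide add.commute)
      with elim show False by auto
    qed
  qed
qed

lemma hbi_Iic: "has_bochner_integral (\<mu> u) (indicator {..x} :: real \<Rightarrow> real) ((norm (E x u))\<^sup>2)"
  using has_bochner_integral_real_indicator[of "{..x}" "\<mu> u"]
  by (simp add: measure_mu_Iic emeasure_mu_Iic)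

text \<open>The isometry rests on the nesting of the projections:
  \<open>E x u \<bullet> E y u\<close> depends only on \<open>min x y\<close>, exactly as the
  product of the two half-line indicators does.\<close>

lemma hbi_Iic_mult:
  "has_bochner_integral (\<mu> u) (\<lambda>r. indicator {..x} r * indicator {..y} r :: real) (E x u \<bullet> E y u)"
  using hbi_Iic[of u "min x y"] unfolding E_inner
  by (rule back_subst[where P="\<lambda>f. has_bochner_integral _ f _"]) (auto simp: indicator_def fun_eq_iff)

lemma hbi_Ioc_mult:
  assumes "a \<le> b" "a' \<le> b'"
  shows "has_bochner_integral (\<mu> u) (\<lambda>r. indicator {a<..b} r * indicator {a'<..b'} r :: real)
    ((E b u - E a u) \<bullet> (E b' u - E a' u))"
proof -
  have "has_bochner_integral (\<mu> u) (\<lambda>r. (indicator {..b} r * indicator {..b'} r - indicator {..b} r * indicator {..a'} r)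
      - (indicator {..a} r * indicator {..b'} r - indicator {..a} r * indicator {..a'} r) :: real)
    ((E b u \<bullet> E b' u - E b u \<bullet> E a' u) - (E a u \<bullet> E b' u - E a u \<bullet> E a' u))"
    by (intro has_bochner_integral_diff hbi_Iic_mult)
  then show ?thesis
    by (rule back_subst[where P="\<lambda>x. x", OF _ arg_cong2[where f="has_bochner_integral (\<mu> u)"]])
      (use assms in \<open>auto simp: indicator_def fun_eq_iff inner_diff_left inner_diff_right\<close>)
qed

text \<open>Both sides are bilinear in the lists, so two nested inductions reduce the identity to
  single intervals. Overlaps are harmless, and no common refinement is formed.\<close>

lemma hbi_step_mult:
  assumes "is_step S" "is_step T"
  shows "has_bochner_integral (\<mu> u) (\<lambda>r. step_fun S r * step_fun T r) (step_op E S u \<bullet> step_op E T u)"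
  using assms(1)
proof (induction S)
  case Nil
  show ?case by (simp add: has_bochner_integral_zero)
next
  case (Cons s S)
  obtain c a b where s: "s = (c, a, b)" by (cases s)
  with Cons.prems have ab: "a \<le> b" by simp
  have "has_bochner_integral (\<mu> u) (\<lambda>r. indicator {a<..b} r * step_fun T r) ((E b u - E a u) \<bullet> step_op E T u)"
    using assms(2)
  proof (induction T)
    case Nil
    show ?case by (simp add: has_bochner_integral_zero)
  next
    case (Cons t T)
    obtain c' a' b' where t: "t = (c', a', b')" by (cases t)
    have "has_bochner_integral (\<mu> u) (\<lambda>r. c' * (indicator {a<..b} r * indicator {a'<..b'} r) + indicator {a<..b} r * step_fun T r)
        (c' * ((E b u - E a u) \<bullet> (E b' u - E a' u)) + (E b u - E a u) \<bullet> step_op E T u)"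
      using Cons t ab by (intro has_bochner_integral_add has_bochner_integral_mult_right hbi_Ioc_mult) auto
    then show ?case
      by (simp add: t step_fun_Cons step_op_Cons algebra_simps inner_add_right)
  qed
  then have "has_bochner_integral (\<mu> u) (\<lambda>r. c * (indicator {a<..b} r * step_fun T r) + step_fun S r * step_fun T r)
        (c * ((E b u - E a u) \<bullet> step_op E T u) + step_op E S u \<bullet> step_op E T u)"
    using Cons s by (intro has_bochner_integral_add has_bochner_integral_mult_right) auto
  then show ?case
    by (simp add: s step_fun_Cons step_op_Cons algebra_simps inner_add_left)
qed

lemma hbi_step_square:
  "is_step S \<Longrightarrow> has_bochner_integral (\<mu> u) (\<lambda>r. (step_fun S r)\<^sup>2) ((norm (step_op E S u))\<^sup>2)"
  using hbi_step_mult[of S S u] by (simp add: power2_eq_square[of "step_fun S _"] power2_norm_eq_inner)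

lemma step_op_cut: "is_step S \<Longrightarrow> step_op E (step_cut t S) u = E t (step_op E S u)"
  by (induction S)
    (auto simp: step_cut_def step_op_Cons linear_add[OF linear_E] linear_diff[OF linear_E]
      linear_scale[OF linear_E] linear_0[OF linear_E] E_E min.commute)

section \<open>Spectral integrals: closedness, linearity, truncation\<close>

lemma has_spectral_integral_iff:
  "hsi f u w \<longleftrightarrow> f \<in> borel_measurable borel \<and>
     (\<forall>\<epsilon>>0. \<exists>S. is_step S \<and> (\<integral>\<^sup>+ r. ennreal ((f r - step_fun S r)\<^sup>2) \<partial>\<mu> u) < ennreal \<epsilon> \<and>
        norm (step_op E S u - w) < \<epsilon>)" (is "_ \<longleftrightarrow> _ \<and> ?R")
proof (cases "f \<in> borel_measurable borel")
  case True
  let ?I = "\<lambda>S. \<integral>\<^sup>+ r. ennreal ((f r - step_fun S r)\<^sup>2) \<partial>\<mu> u"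
  have "(\<exists>S. (\<forall>n::nat. is_step (S n)) \<and> (\<lambda>n. ?I (S n)) \<longlonglongrightarrow> 0 \<and> (\<lambda>n. step_op E (S n) u) \<longlonglongrightarrow> w) \<longleftrightarrow> ?R"
    (is "?L \<longleftrightarrow> _")
  proof
    assume ?L
    then obtain S where S: "\<And>n::nat. is_step (S n)" "(\<lambda>n. ?I (S n)) \<longlonglongrightarrow> 0" "(\<lambda>n. step_op E (S n) u) \<longlonglongrightarrow> w"
      by blast
    show ?R
    proof (intro allI impI)
      fix \<epsilon> :: real assume "0 < \<epsilon>"
      then have "\<forall>\<^sub>F n in sequentially. ?I (S n) < ennreal \<epsilon> \<and> dist (step_op E (S n) u) w < \<epsilon>"
        using order_tendstoD(2)[OF S(2), of "ennreal \<epsilon>"] tendstoD[OF S(3), of \<epsilon>]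
        by (auto intro: eventually_conj)
      then obtain n where "?I (S n) < ennreal \<epsilon> \<and> dist (step_op E (S n) u) w < \<epsilon>"
        using eventually_happens by fastforce
      with S(1) show "\<exists>S. is_step S \<and> ?I S < ennreal \<epsilon> \<and> norm (step_op E S u - w) < \<epsilon>"
        by (auto simp: dist_norm)
    qed
  next
    assume R: ?R
    have "\<forall>n::nat. \<exists>S. is_step S \<and> ?I S < ennreal (inverse (Suc n)) \<and> norm (step_op E S u - w) < inverse (Suc n)"
      using R by simp
    then obtain S where S: "\<And>n. is_step (S n)" "\<And>n. ?I (S n) < ennreal (inverse (Suc n))"
      "\<And>n. norm (step_op E (S n) u - w) < inverse (Suc n)"
      by metis
    have "(\<lambda>n. ?I (S n)) \<longlonglongrightarrow> 0"
    proof (rule tendsto_sandwich[OF _ _ tendsto_const])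
      show "(\<lambda>n. ennreal (inverse (Suc n))) \<longlonglongrightarrow> 0"
        using tendsto_ennrealI[OF LIMSEQ_inverse_real_of_nat] by simp
    qed (auto intro!: always_eventually less_imp_le S(2) simp del: of_nat_Suc)
    moreover have "(\<lambda>n. step_op E (S n) u - w) \<longlonglongrightarrow> 0"
      by (rule Lim_null_comparison[OF _ LIMSEQ_inverse_real_of_nat]) (auto intro!: always_eventually less_imp_le S(3) simp del: of_nat_Suc)
    then have "(\<lambda>n. step_op E (S n) u) \<longlonglongrightarrow> w"
      by (simp add: LIM_zero_iff)
    ultimately show ?L using S(1) by blast
  qed
  with True show ?thesis by (simp add: has_spectral_integral_def)
qed (simp add: has_spectral_integral_def)

lemma hsi_measurable: "hsi f u w \<Longrightarrow> f \<in> borel_measurable borel"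
  by (simp add: has_spectral_integral_def)

lemma hsi_step: "is_step S \<Longrightarrow> hsi (step_fun S) u (step_op E S u)"
  unfolding has_spectral_integral_iff by (auto intro!: exI[of _ S])

text \<open>The integral is closed: the approximating integrands may themselves be general spectral
  integrals. The characterization by a single \<epsilon> replaces the choice of a diagonal
  sequence.\<close>

lemma hsi_limit:
  assumes f: "f \<in> borel_measurable borel"
    and approx: "\<And>\<epsilon>. \<epsilon> > 0 \<Longrightarrow> \<exists>g z. hsi g u z \<and> (\<integral>\<^sup>+ r. ennreal ((f r - g r)\<^sup>2) \<partial>\<mu> u) < ennreal \<epsilon> \<and>
        norm (z - w) < \<epsilon>"
  shows "hsi f u w"
  unfolding has_spectral_integral_iff
proof (intro conjI allI impI f)
  fix \<epsilon> :: real assume "0 < \<epsilon>"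
  \<comment> \<open>Bounding the square of a sum by twice the sum of the squares doubles each error,
    so \<open>\<epsilon> / 8\<close> leaves \<open>\<epsilon> / 2\<close> for the integral and
    \<open>\<epsilon> / 4\<close> for the norm.\<close>
  then have e8: "0 < \<epsilon> / 8" by simp
  from approx[OF e8] obtain g z where g: "hsi g u z" "(\<integral>\<^sup>+ r. ennreal ((f r - g r)\<^sup>2) \<partial>\<mu> u) < ennreal (\<epsilon> / 8)"
    "norm (z - w) < \<epsilon> / 8" by blast
  from g(1) e8 obtain S where S: "is_step S" "(\<integral>\<^sup>+ r. ennreal ((g r - step_fun S r)\<^sup>2) \<partial>\<mu> u) < ennreal (\<epsilon> / 8)"
    "norm (step_op E S u - z) < \<epsilon> / 8"
    unfolding has_spectral_integral_iff by blast
  note [measurable] = f hsi_measurable[OF g(1)]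
  have "(\<integral>\<^sup>+ r. ennreal ((f r - step_fun S r)\<^sup>2) \<partial>\<mu> u)
      \<le> (\<integral>\<^sup>+ r. 2 * ennreal ((f r - g r)\<^sup>2) + 2 * ennreal ((g r - step_fun S r)\<^sup>2) \<partial>\<mu> u)"
  proof (rule nn_integral_mono)
    fix r
    have "(f r - step_fun S r)\<^sup>2 \<le> 2 * (f r - g r)\<^sup>2 + 2 * (g r - step_fun S r)\<^sup>2"
      using sum_squares_bound[of "f r - g r" "g r - step_fun S r"] by (simp add: power2_eq_square algebra_simps)
    then show "ennreal ((f r - step_fun S r)\<^sup>2) \<le> 2 * ennreal ((f r - g r)\<^sup>2) + 2 * ennreal ((g r - step_fun S r)\<^sup>2)"
      by (simp add: ennreal_plus[symmetric] ennreal_mult[symmetric] ennreal_leI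
          flip: ennreal_numeral del: ennreal_plus)
  qed
  also have "\<dots> = 2 * (\<integral>\<^sup>+ r. ennreal ((f r - g r)\<^sup>2) \<partial>\<mu> u) + 2 * (\<integral>\<^sup>+ r. ennreal ((g r - step_fun S r)\<^sup>2) \<partial>\<mu> u)"
    by (subst nn_integral_add) (auto simp: nn_integral_cmult)
  also have "\<dots> \<le> 2 * ennreal (\<epsilon> / 8) + 2 * ennreal (\<epsilon> / 8)"
    by (intro add_mono mult_left_mono less_imp_le g S) auto
  also have "\<dots> = ennreal (\<epsilon> / 2)"
    using \<open>0 < \<epsilon>\<close> by (simp flip: ennreal_plus ennreal_numeral ennreal_mult)
  also have "\<dots> < ennreal \<epsilon>"
    using \<open>0 < \<epsilon>\<close> by (simp add: ennreal_lessI)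
  finally have "(\<integral>\<^sup>+ r. ennreal ((f r - step_fun S r)\<^sup>2) \<partial>\<mu> u) < ennreal \<epsilon>" .
  moreover have "norm (step_op E S u - w) < \<epsilon>"
    using norm_triangle_ineq[of "step_op E S u - z" "z - w"] S(3) g(3) e8 by simp
  ultimately show "\<exists>S. is_step S \<and> (\<integral>\<^sup>+ r. ennreal ((f r - step_fun S r)\<^sup>2) \<partial>\<mu> u) < ennreal \<epsilon> \<and>
        norm (step_op E S u - w) < \<epsilon>" using S(1) by blast
qed

lemma hsi_linear:
  assumes "hsi f u w" "hsi g u z"
  shows "hsi (\<lambda>r. a * f r + b * g r) u (a *\<^sub>R w + b *\<^sub>R z)"
proof -
  note [measurable] = hsi_measurable[OF assms(1)] hsi_measurable[OF assms(2)]
  let ?I = "\<lambda>f S. \<integral>\<^sup>+ r. ennreal ((f r - step_fun S r)\<^sup>2) \<partial>\<mu> u"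
  obtain S where S: "\<And>n::nat. is_step (S n)" "(\<lambda>n. ?I f (S n)) \<longlonglongrightarrow> 0" "(\<lambda>n. step_op E (S n) u) \<longlonglongrightarrow> w"
    using assms(1) by (auto simp: has_spectral_integral_def)
  obtain T where T: "\<And>n::nat. is_step (T n)" "(\<lambda>n. ?I g (T n)) \<longlonglongrightarrow> 0" "(\<lambda>n. step_op E (T n) u) \<longlonglongrightarrow> z"
    using assms(2) by (auto simp: has_spectral_integral_def)
  let ?h = "\<lambda>r. a * f r + b * g r"
  let ?U = "\<lambda>n. step_scale a (S n) @ step_scale b (T n)"
  have "(\<lambda>n. ?I ?h (?U n)) \<longlonglongrightarrow> 0"
  proof (rule tendsto_sandwich[OF _ _ tendsto_const])
    have "(\<lambda>n. ennreal (2 * a\<^sup>2) * ?I f (S n) + ennreal (2 * b\<^sup>2) * ?I g (T n)) \<longlonglongrightarrow>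
        ennreal (2 * a\<^sup>2) * 0 + ennreal (2 * b\<^sup>2) * 0"
      by (intro tendsto_add ennreal_tendsto_cmult S T) auto
    then show "(\<lambda>n. ennreal (2 * a\<^sup>2) * ?I f (S n) + ennreal (2 * b\<^sup>2) * ?I g (T n)) \<longlonglongrightarrow> 0" by simp
    have "?I ?h (?U n) \<le> ennreal (2 * a\<^sup>2) * ?I f (S n) + ennreal (2 * b\<^sup>2) * ?I g (T n)" for n
    proof -
      have "?I ?h (?U n) \<le> (\<integral>\<^sup>+ r. ennreal (2 * a\<^sup>2) * ennreal ((f r - step_fun (S n) r)\<^sup>2)
          + ennreal (2 * b\<^sup>2) * ennreal ((g r - step_fun (T n) r)\<^sup>2) \<partial>\<mu> u)"
      proof (rule nn_integral_mono)
        fix r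
        have "(?h r - step_fun (?U n) r)\<^sup>2 = (a * (f r - step_fun (S n) r) + b * (g r - step_fun (T n) r))\<^sup>2"
          by (simp add: step_fun_append step_fun_scale algebra_simps)
        also have "\<dots> \<le> 2 * a\<^sup>2 * (f r - step_fun (S n) r)\<^sup>2 + 2 * b\<^sup>2 * (g r - step_fun (T n) r)\<^sup>2"
          using sum_squares_bound[of "a * (f r - step_fun (S n) r)" "b * (g r - step_fun (T n) r)"]
          by (simp only: power2_sum power_mult_distrib)
        finally show "ennreal ((?h r - step_fun (?U n) r)\<^sup>2) \<le> ennreal (2 * a\<^sup>2) * ennreal ((f r - step_fun (S n) r)\<^sup>2)
          + ennreal (2 * b\<^sup>2) * ennreal ((g r - step_fun (T n) r)\<^sup>2)"
          by (simp add: ennreal_leI flip: ennreal_plus ennreal_mult)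
      qed
      also have "\<dots> = ennreal (2 * a\<^sup>2) * ?I f (S n) + ennreal (2 * b\<^sup>2) * ?I g (T n)"
        by (simp add: nn_integral_add nn_integral_cmult)
      finally show ?thesis .
    qed
    then show "\<forall>\<^sub>F n in sequentially. ?I ?h (?U n) \<le> ennreal (2 * a\<^sup>2) * ?I f (S n) + ennreal (2 * b\<^sup>2) * ?I g (T n)"
      by (rule always_eventually[OF allI])
  qed simp
  moreover have "(\<lambda>n. step_op E (?U n) u) \<longlonglongrightarrow> a *\<^sub>R w + b *\<^sub>R z"
    unfolding step_op_append step_op_scale by (intro tendsto_intros S T)
  ultimately show ?thesis
    unfolding has_spectral_integral_def using S(1) T(1)
    by (auto intro!: exI[of _ ?U] is_step_scale)
qed

lemma hsi_diff: "hsi f u w \<Longrightarrow> hsi g u z \<Longrightarrow> hsi (\<lambda>r. f r - g r) u (w - z)"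
  using hsi_linear[of f u w g z 1 "-1"] by simp

lemma hsi_scale: "hsi f u w \<Longrightarrow> hsi (\<lambda>r. a * f r) u (a *\<^sub>R w)"
  using hsi_linear[of f u w f w a 0] by simp

text \<open>Truncation does not increase the L2 error and \<open>E t\<close> is bounded, so an
  approximating sequence remains one after \<open>step_cut\<close>.\<close>

lemma hsi_cut:
  assumes "hsi f u w"
  shows "hsi (\<lambda>r. indicator {..t} r * f r) u (E t w)"
proof -
  note [measurable] = hsi_measurable[OF assms]
  obtain S where S: "\<And>n::nat. is_step (S n)"
      "(\<lambda>n. \<integral>\<^sup>+ r. ennreal ((f r - step_fun (S n) r)\<^sup>2) \<partial>\<mu> u) \<longlonglongrightarrow> 0" "(\<lambda>n. step_op E (S n) u) \<longlonglongrightarrow> w"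
    using assms by (auto simp: has_spectral_integral_def)
  have "(\<lambda>n. \<integral>\<^sup>+ r. ennreal ((indicator {..t} r * f r - step_fun (step_cut t (S n)) r)\<^sup>2) \<partial>\<mu> u) \<longlonglongrightarrow> 0"
    by (rule tendsto_sandwich[OF _ _ tendsto_const S(2)])
      (auto intro!: always_eventually nn_integral_mono ennreal_leI simp: step_fun_cut indicator_def)
  moreover have "(\<lambda>n. step_op E (step_cut t (S n)) u) \<longlonglongrightarrow> E t w"
    unfolding step_op_cut[OF S(1)] by (rule bounded_linear.tendsto[OF bounded_linear_E S(3)])
  ultimately show ?thesis
    unfolding has_spectral_integral_def using S(1)
    by (auto intro!: exI[of _ "\<lambda>n. step_cut t (S n)"] is_step_cut)
qed

section \<open>Isometry, uniqueness and composition\<close>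

lemma hsi_isometry:
  assumes "hsi f u w"
  shows "has_bochner_integral (\<mu> u) (\<lambda>r. (f r)\<^sup>2) ((norm w)\<^sup>2)"
proof -
  note [measurable] = hsi_measurable[OF assms]
  \<comment> \<open>The squared L2 error is kept below \<open>(?d n)\<^sup>2\<close>, so that it
    still tends to zero after the division by \<open>?d n\<close> in the weighted inequality
    below.\<close>
  let ?d = "\<lambda>n::nat. 1 / (real n + 1)"
  have "\<forall>n. \<exists>S. is_step S \<and> (\<integral>\<^sup>+ r. ennreal ((f r - step_fun S r)\<^sup>2) \<partial>\<mu> u) < ennreal ((?d n)\<^sup>2) \<and>
      norm (step_op E S u - w) < (?d n)\<^sup>2"
    using assms by (auto simp: has_spectral_integral_iff)
  from choice[OF this] obtain S where S: "\<And>n. is_step (S n)"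
      "\<And>n. (\<integral>\<^sup>+ r. ennreal ((f r - step_fun (S n) r)\<^sup>2) \<partial>\<mu> u) < ennreal ((?d n)\<^sup>2)"
      "\<And>n. norm (step_op E (S n) u - w) < (?d n)\<^sup>2"
    by blast
  let ?D = "\<lambda>n r. (f r - step_fun (S n) r)\<^sup>2"
  have d0: "?d \<longlonglongrightarrow> 0"
    using LIMSEQ_inverse_real_of_nat by (simp add: inverse_eq_divide add.commute)
  have d20: "(\<lambda>n. (?d n)\<^sup>2) \<longlonglongrightarrow> 0"
    using tendsto_power[OF d0, of 2] by simp
  have intD: "integrable (\<mu> u) (?D n)" for n
    using S(2)[of n] by (intro integrableI_bounded) (auto intro: less_trans)
  have D_le: "(\<integral>r. ?D n r \<partial>\<mu> u) \<le> (?d n)\<^sup>2" for n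
    using less_imp_le[OF S(2)[of n]] by (subst integral_eq_nn_integral) (auto intro!: enn2real_leI)
  have intS: "integrable (\<mu> u) (\<lambda>r. (step_fun (S n) r)\<^sup>2)"
    and S_eq: "(\<integral>r. (step_fun (S n) r)\<^sup>2 \<partial>\<mu> u) = (norm (step_op E (S n) u))\<^sup>2" for n
    using hbi_step_square[OF S(1)] by (auto simp: has_bochner_integral_iff)
  have int: "integrable (\<mu> u) (\<lambda>r. (f r)\<^sup>2)"
  proof (rule Bochner_Integration.integrable_bound)
    show "integrable (\<mu> u) (\<lambda>r. 2 * ?D 0 r + 2 * (step_fun (S 0) r)\<^sup>2)"
      using intD[of 0] intS[of 0] by simp
    have "(f r)\<^sup>2 \<le> 2 * ?D 0 r + 2 * (step_fun (S 0) r)\<^sup>2" for r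
      using sum_squares_bound[of "f r - step_fun (S 0) r" "step_fun (S 0) r"]
      by (simp add: power2_eq_square algebra_simps)
    then show "AE r in \<mu> u. norm ((f r)\<^sup>2) \<le> norm (2 * ?D 0 r + 2 * (step_fun (S 0) r)\<^sup>2)"
      by (intro AE_I2) (simp add: order_trans)
  qed simp
  let ?A = "\<integral>r. (f r)\<^sup>2 \<partial>\<mu> u"
  have "norm ((norm (step_op E (S n) u))\<^sup>2 - ?A) \<le> ?d n * ?A + (?d n)\<^sup>2 + ?d n" for n
  proof -
    have dpos: "0 < ?d n" by simp
    have "norm ((norm (step_op E (S n) u))\<^sup>2 - ?A) = norm (\<integral>r. (step_fun (S n) r)\<^sup>2 - (f r)\<^sup>2 \<partial>\<mu> u)"
      using S_eq[of n] intS[of n] int by simp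
    also have "\<dots> \<le> (\<integral>r. ?d n * (f r)\<^sup>2 + (1 + 1 / ?d n) * ?D n r \<partial>\<mu> u)"
    proof (rule Bochner_Integration.integral_norm_bound_integral)
      show "integrable (\<mu> u) (\<lambda>r. (step_fun (S n) r)\<^sup>2 - (f r)\<^sup>2)"
        using intS[of n] int by simp
      show "integrable (\<mu> u) (\<lambda>r. ?d n * (f r)\<^sup>2 + (1 + 1 / ?d n) * ?D n r)"
        using intD[of n] int by simp
      fix r
      define x y where "x = f r" and "y = f r - step_fun (S n) r"
      \<comment> \<open>Young's inequality with a free weight. Taken with \<open>t = ?d n\<close> it
        controls the cross term without an L2 triangle inequality.\<close>
      have key: "2 * \<bar>x * y\<bar> \<le> t * x\<^sup>2 + y\<^sup>2 / t" if "t > 0" for t :: real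
      proof -
        have "0 \<le> (t * \<bar>x\<bar> - \<bar>y\<bar>)\<^sup>2 / t" using that by simp
        also have "\<dots> = t * x\<^sup>2 + y\<^sup>2 / t - 2 * \<bar>x * y\<bar>"
          using that by (simp add: power2_eq_square abs_mult field_simps)
        finally show ?thesis by simp
      qed
      have "norm ((step_fun (S n) r)\<^sup>2 - (f r)\<^sup>2) = \<bar>y\<^sup>2 - 2 * (x * y)\<bar>"
        by (simp add: x_def y_def power2_eq_square algebra_simps)
      also have "\<dots> \<le> y\<^sup>2 + 2 * \<bar>x * y\<bar>"
        using abs_triangle_ineq4[of "y\<^sup>2" "2 * (x * y)"] by (simp add: abs_mult)
      also have "\<dots> \<le> ?d n * x\<^sup>2 + (1 + 1 / ?d n) * y\<^sup>2"
        using key[OF dpos] by (simp add: algebra_simps)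
      finally show "norm ((step_fun (S n) r)\<^sup>2 - (f r)\<^sup>2) \<le> ?d n * (f r)\<^sup>2 + (1 + 1 / ?d n) * ?D n r"
        by (simp add: x_def y_def)
    qed
    also have "\<dots> = ?d n * ?A + (1 + 1 / ?d n) * (\<integral>r. ?D n r \<partial>\<mu> u)"
      using intD[of n] int by simp
    also have "\<dots> \<le> ?d n * ?A + (1 + 1 / ?d n) * (?d n)\<^sup>2"
      by (intro add_left_mono mult_left_mono D_le) simp
    also have "\<dots> = ?d n * ?A + (?d n)\<^sup>2 + ?d n"
    proof -
      have "(1 + 1 / x) * x\<^sup>2 = x\<^sup>2 + x" if "x \<noteq> 0" for x :: real
        using that by (simp add: power2_eq_square field_simps)
      from this[of "?d n"] show ?thesis by simp
    qed
    finally show ?thesis .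
  qed
  moreover have "(\<lambda>n. ?d n * ?A + (?d n)\<^sup>2 + ?d n) \<longlonglongrightarrow> 0"
    using tendsto_add[OF tendsto_add[OF tendsto_mult_left_zero[OF d0] d20] d0] by simp
  ultimately have "(\<lambda>n. (norm (step_op E (S n) u))\<^sup>2 - ?A) \<longlonglongrightarrow> 0"
    by (rule Lim_null_comparison[OF always_eventually[OF allI]])
  then have "(\<lambda>n. (norm (step_op E (S n) u))\<^sup>2) \<longlonglongrightarrow> ?A"
    by (simp add: LIM_zero_iff)
  moreover have "(\<lambda>n. step_op E (S n) u - w) \<longlonglongrightarrow> 0"
    by (rule Lim_null_comparison[OF _ d20]) (intro always_eventually allI less_imp_le S(3))
  then have "(\<lambda>n. step_op E (S n) u) \<longlonglongrightarrow> w"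
    by (simp add: LIM_zero_iff)
  then have "(\<lambda>n. (norm (step_op E (S n) u))\<^sup>2) \<longlonglongrightarrow> (norm w)\<^sup>2"
    by (intro tendsto_power tendsto_norm)
  ultimately have "?A = (norm w)\<^sup>2"
    by (rule LIMSEQ_unique)
  with int show ?thesis by (simp add: has_bochner_integral_iff)
qed

text \<open>The difference of two values is an integral of the zero function, so the isometry makes
  it vanish. This justifies the definite description in \<open>spectral_op\<close>.\<close>

lemma hsi_unique:
  assumes "hsi f u w" "hsi f u z"
  shows "w = z"
proof -
  have "has_bochner_integral (\<mu> u) (\<lambda>r. 0) ((norm (w - z))\<^sup>2)"
    using hsi_isometry[OF hsi_diff[OF assms]] by simp
  then show ?thesis
    by (simp add: has_bochner_integral_iff)
qed

lemma spectral_op_eqI: "hsi f u w \<Longrightarrow> spectral_op E f u = w"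
  unfolding spectral_op_def using hsi_unique by blast

lemma hsi_nn_isometry: "hsi f u w \<Longrightarrow> (\<integral>\<^sup>+ r. ennreal ((f r)\<^sup>2) \<partial>\<mu> u) = ennreal ((norm w)\<^sup>2)"
  using hsi_isometry[of f u w] by (simp add: has_bochner_integral_iff nn_integral_eq_integral)

text \<open>Truncation at \<open>x\<close> followed by the isometry expresses
  \<open>(norm (E x w))\<^sup>2\<close> as the integral of \<open>(f r)\<^sup>2\<close> over
  \<open>{..x}\<close>, so both measures have the same distribution function. Questions about
  \<open>w\<close> thereby become questions about \<open>u\<close>.\<close>

lemma mu_hsi:
  assumes "hsi f u w"
  shows "\<mu> w = density (\<mu> u) (\<lambda>r. ennreal ((f r)\<^sup>2))"
proof (rule cdf_unique')
  note [measurable] = hsi_measurable[OF assms]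
  let ?\<nu> = "density (\<mu> u) (\<lambda>r. ennreal ((f r)\<^sup>2))"
  show "finite_borel_measure (\<mu> w)" by (rule finite_borel_measure_mu)
  have e: "emeasure ?\<nu> UNIV \<noteq> \<infinity>"
    by (simp add: emeasure_density hsi_nn_isometry[OF assms])
  show "finite_borel_measure ?\<nu>"
    unfolding finite_borel_measure_def finite_borel_measure_axioms_def
    using e by (auto intro!: finite_measureI)
  show "cdf (\<mu> w) = cdf ?\<nu>"
  proof
    fix x
    have "emeasure ?\<nu> {..x} = (\<integral>\<^sup>+ r. ennreal ((indicator {..x} r * f r)\<^sup>2) \<partial>\<mu> u)"
      by (auto simp: emeasure_density indicator_def intro!: nn_integral_cong)
    also have "\<dots> = ennreal ((norm (E x w))\<^sup>2)"
      by (rule hsi_nn_isometry[OF hsi_cut[OF assms]])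
    finally show "cdf (\<mu> w) x = cdf ?\<nu> x"
      unfolding cdf_def measure_mu_Iic by (simp add: measure_def)
  qed
qed

lemma hsi_compose_step:
  assumes "hsi g u w" "is_step S"
  shows "hsi (\<lambda>r. step_fun S r * g r) u (step_op E S w)"
  using assms(2)
proof (induction S)
  case Nil
  show ?case using hsi_scale[OF assms(1), of 0] by simp
next
  case (Cons s S)
  obtain c a b where s: "s = (c, a, b)" by (cases s)
  with Cons have "a \<le> b" "is_step S" by auto
  have "hsi (\<lambda>r. c * (indicator {..b} r * g r - indicator {..a} r * g r) + 1 * (step_fun S r * g r)) u
      (c *\<^sub>R (E b w - E a w) + 1 *\<^sub>R step_op E S w)"
    by (intro hsi_linear hsi_diff hsi_cut assms Cons.IH \<open>is_step S\<close>)
  moreover have "(\<lambda>r. c * (indicator {..b} r * g r - indicator {..a} r * g r) + 1 * (step_fun S r * g r))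
      = (\<lambda>r. step_fun (s # S) r * g r)"
    using \<open>a \<le> b\<close> by (auto simp: s step_fun_Cons indicator_def fun_eq_iff algebra_simps)
  ultimately show ?case
    by (simp add: s step_op_Cons)
qed

text \<open>By \<open>mu_hsi\<close>, the L2 error of a step function against \<open>f\<close> at
  \<open>w\<close> equals the error of its product with \<open>g\<close> against
  \<open>f r * g r\<close> at \<open>u\<close>. Hence approximants of \<open>f\<close> also serve
  for the product, and closedness concludes.\<close>

lemma hsi_compose:
  assumes g: "hsi g u w" and f: "hsi f w z"
  shows "hsi (\<lambda>r. f r * g r) u z"
proof (rule hsi_limit)
  note [measurable] = hsi_measurable[OF g] hsi_measurable[OF f]
  show "(\<lambda>r. f r * g r) \<in> borel_measurable borel" by measurable
  fix \<epsilon> :: real assume "\<epsilon> > 0"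
  with f obtain S where S: "is_step S" "(\<integral>\<^sup>+ r. ennreal ((f r - step_fun S r)\<^sup>2) \<partial>\<mu> w) < ennreal \<epsilon>"
      "norm (step_op E S w - z) < \<epsilon>"
    unfolding has_spectral_integral_iff by blast
  have "(\<integral>\<^sup>+ r. ennreal ((f r * g r - step_fun S r * g r)\<^sup>2) \<partial>\<mu> u) =
      (\<integral>\<^sup>+ r. ennreal ((g r)\<^sup>2) * ennreal ((f r - step_fun S r)\<^sup>2) \<partial>\<mu> u)"
    by (intro nn_integral_cong)
      (simp add: power_mult_distrib mult.commute[of "(g _)\<^sup>2"] flip: ennreal_mult left_diff_distrib)
  also have "\<dots> = (\<integral>\<^sup>+ r. ennreal ((f r - step_fun S r)\<^sup>2) \<partial>\<mu> w)"
    unfolding mu_hsi[OF g] by (subst nn_integral_density) auto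
  finally show "\<exists>h z'. hsi h u z' \<and> (\<integral>\<^sup>+ r. ennreal ((f r * g r - h r)\<^sup>2) \<partial>\<mu> u) < ennreal \<epsilon> \<and> norm (z' - z) < \<epsilon>"
    using S hsi_compose_step[OF g S(1)]
    by (intro exI[of _ "\<lambda>r. step_fun S r * g r"] exI[of _ "step_op E S w"]) simp
qed

section \<open>Existence for continuous integrands\<close>

lemma step_approx_on_interval:
  assumes unif: "\<And>r s. \<lbrakk>r \<in> {0..K}; s \<in> {0..K}; \<bar>r - s\<bar> \<le> h\<rbrakk> \<Longrightarrow> \<bar>f r - f s\<bar> \<le> \<delta>"
    and "0 \<le> h" "0 \<le> \<delta>" "real n * h \<le> K"
  shows "\<exists>S. is_step S \<and> (\<forall>r\<in>{0..real n * h}. \<bar>f r - step_fun S r\<bar> \<le> \<delta>) \<and> (\<forall>r>real n * h. step_fun S r = 0)"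
  using assms(4)
proof (induction n)
  case 0
  show ?case
    \<comment> \<open>Left endpoints are excluded, so the point 0, a possible atom, is covered by a
      cell that starts at -1.\<close>
    using \<open>0 \<le> \<delta>\<close> by (intro exI[of _ "[(f 0, -1, 0)]"]) (auto simp: step_fun_Cons)
next
  case (Suc n)
  have K: "real n * h \<le> real (Suc n) * h" "real (Suc n) * h \<le> K"
    using Suc.prems \<open>0 \<le> h\<close> by (auto intro: mult_right_mono)
  with Suc.IH obtain S where S: "is_step S" "\<And>r. r \<in> {0..real n * h} \<Longrightarrow> \<bar>f r - step_fun S r\<bar> \<le> \<delta>"
      "\<And>r. r > real n * h \<Longrightarrow> step_fun S r = 0"
    by force
  \<comment> \<open>The new cell takes the value of \<open>f\<close> at its right endpoint; the old
    step function vanishes there, so nothing is added twice.\<close>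
  let ?T = "(f (real (Suc n) * h), real n * h, real (Suc n) * h) # S"
  have "\<bar>f r - step_fun ?T r\<bar> \<le> \<delta>" if r: "r \<in> {0..real (Suc n) * h}" for r
  proof (cases "r \<le> real n * h")
    case True
    then show ?thesis using r S(2)[of r] by (simp add: step_fun_Cons)
  next
    case False
    then have "\<bar>r - real (Suc n) * h\<bar> \<le> h"
      using r by (auto simp: algebra_simps)
    then show ?thesis
      using unif[of r "real (Suc n) * h"] r K False S(3)[of r] \<open>0 \<le> h\<close> by (auto simp: step_fun_Cons)
  qed
  then show ?case
    using S(1,3) K by (intro exI[of _ ?T]) (auto simp: step_fun_Cons)
qed

text \<open>The tail beyond a large integer \<open>K\<close> is small by dominated convergence. On
  \<open>{0..K}\<close> uniform continuity gives a uniformly close step function, and the finite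
  total mass turns this into an L2 bound.\<close>

lemma step_approx_continuous:
  assumes f: "f \<in> borel_measurable borel" "continuous_on {0..} f" and u: "u \<in> spectral_dom E f" and "0 < \<epsilon>"
  shows "\<exists>S. is_step S \<and> (\<integral>\<^sup>+ r. ennreal ((f r - step_fun S r)\<^sup>2) \<partial>\<mu> u) < ennreal \<epsilon>"
proof -
  note [measurable] = f(1)
  interpret finite_measure "\<mu> u" by (rule finite_mu)
  have int: "integrable (\<mu> u) (\<lambda>r. (f r)\<^sup>2)"
    using u by (simp add: spectral_dom_def)
  have "(\<lambda>n::nat. \<integral>r. indicator {real n<..} r * (f r)\<^sup>2 \<partial>\<mu> u) \<longlonglongrightarrow> (\<integral>r. 0 \<partial>\<mu> u)"
  proof (rule integral_dominated_convergence[where w="\<lambda>r. (f r)\<^sup>2"])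
    show "AE r in \<mu> u. (\<lambda>n. indicator {real n<..} r * (f r)\<^sup>2) \<longlonglongrightarrow> 0"
    proof (rule AE_I2)
      fix r :: real
      have "\<forall>\<^sub>F n in sequentially. r \<le> real n"
        using eventually_ge_at_top[of "nat \<lceil>r\<rceil>"] by eventually_elim linarith
      then have "\<forall>\<^sub>F n in sequentially. indicator {real n<..} r * (f r)\<^sup>2 = 0"
        by eventually_elim simp
      then show "(\<lambda>n. indicator {real n<..} r * (f r)\<^sup>2) \<longlonglongrightarrow> 0"
        by (rule tendsto_eventually)
    qed
  qed (use int in \<open>auto simp: indicator_def\<close>)
  then have "\<forall>\<^sub>F n::nat in sequentially. (\<integral>r. indicator {real n<..} r * (f r)\<^sup>2 \<partial>\<mu> u) < \<epsilon> / 2"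
    using order_tendstoD(2)[of _ "0::real" sequentially "\<epsilon> / 2"] \<open>0 < \<epsilon>\<close> by simp
  then obtain k :: nat where k: "(\<integral>r. indicator {real k<..} r * (f r)\<^sup>2 \<partial>\<mu> u) < \<epsilon> / 2"
    using eventually_happens by fastforce
  define K where "K = real k"
  have tail: "(\<integral>\<^sup>+ r. ennreal (indicator {K<..} r * (f r)\<^sup>2) \<partial>\<mu> u) < ennreal (\<epsilon> / 2)"
    using k int \<open>0 < \<epsilon>\<close>
    by (subst nn_integral_eq_integral)
      (auto simp: K_def ennreal_lessI intro!: integrable_real_mult_indicator[of _ _ "\<lambda>r. (f r)\<^sup>2", simplified mult.commute])
  define m where "m = measure (\<mu> u) UNIV"
  have m: "0 \<le> m" by (simp add: m_def)
  \<comment> \<open>A uniform error \<open>\<delta>\<close> costs at most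
    \<open>\<delta>\<^sup>2 * m\<close> in the integral, which may use half of
    \<open>\<epsilon>\<close>; \<open>m + 1\<close> keeps the quotient meaningful for the zero
    measure.\<close>
  define \<delta> where "\<delta> = sqrt (\<epsilon> / (2 * (m + 1)))"
  have \<delta>: "0 < \<delta>" "\<delta>\<^sup>2 * m \<le> \<epsilon> / 2"
    using \<open>0 < \<epsilon>\<close> m by (auto simp: \<delta>_def field_simps)
  have "uniformly_continuous_on {0..K} f"
    by (intro compact_uniformly_continuous continuous_on_subset[OF f(2)]) auto
  then obtain \<eta> where \<eta>: "0 < \<eta>" "\<And>r s. \<lbrakk>r \<in> {0..K}; s \<in> {0..K}; dist s r < \<eta>\<rbrakk> \<Longrightarrow> dist (f s) (f r) < \<delta>"
    using \<delta>(1) unfolding uniformly_continuous_on_def by metis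
  obtain n :: nat where n: "K / \<eta> < real n"
    using reals_Archimedean2 by blast
  have "0 \<le> K / \<eta>"
    using \<eta>(1) by (simp add: K_def)
  with n have n0: "0 < real n" by linarith
  define h where "h = K / real n"
  have h: "0 \<le> h" "h < \<eta>" "real n * h = K"
    using n n0 \<eta>(1) by (auto simp: h_def K_def field_simps)
  have unif: "\<bar>f r - f s\<bar> \<le> \<delta>" if "r \<in> {0..K}" "s \<in> {0..K}" "\<bar>r - s\<bar> \<le> h" for r s
    using \<eta>(2)[of s r] that h(2) by (simp add: dist_real_def)
  have "\<exists>S. is_step S \<and> (\<forall>r\<in>{0..K}. \<bar>f r - step_fun S r\<bar> \<le> \<delta>) \<and> (\<forall>r>K. step_fun S r = 0)"
    by (rule step_approx_on_interval[of K h f \<delta> n, OF unif h(1) less_imp_le[OF \<delta>(1)], unfolded h(3)]) auto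
  then obtain S where S: "is_step S"
      "\<And>r. r \<in> {0..K} \<Longrightarrow> \<bar>f r - step_fun S r\<bar> \<le> \<delta>" "\<And>r. r > K \<Longrightarrow> step_fun S r = 0"
    by blast
  have "(\<integral>\<^sup>+ r. ennreal ((f r - step_fun S r)\<^sup>2) \<partial>\<mu> u) \<le> (\<integral>\<^sup>+ r. ennreal (\<delta>\<^sup>2) + ennreal (indicator {K<..} r * (f r)\<^sup>2) \<partial>\<mu> u)"
  proof (rule nn_integral_mono_AE, use AE_mu_nonneg[of u] in eventually_elim)
    case (elim r)
    have "(f r - step_fun S r)\<^sup>2 \<le> \<delta>\<^sup>2 + indicator {K<..} r * (f r)\<^sup>2"
    proof (cases "r \<le> K")
      case True
      then have "\<bar>f r - step_fun S r\<bar>\<^sup>2 \<le> \<delta>\<^sup>2"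
        using S(2)[of r] elim by (intro power_mono) auto
      with True show ?thesis by simp
    next
      case False
      then show ?thesis using S(3)[of r] by simp
    qed
    then show ?case
      by (simp add: ennreal_leI flip: ennreal_plus)
  qed
  also have "\<dots> = ennreal (\<delta>\<^sup>2 * m) + (\<integral>\<^sup>+ r. ennreal (indicator {K<..} r * (f r)\<^sup>2) \<partial>\<mu> u)"
    by (subst nn_integral_add) (auto simp: m_def emeasure_eq_measure ennreal_mult)
  also have "\<dots> \<le> ennreal (\<epsilon> / 2) + (\<integral>\<^sup>+ r. ennreal (indicator {K<..} r * (f r)\<^sup>2) \<partial>\<mu> u)"
    by (intro add_right_mono ennreal_leI \<delta>)
  also have "\<dots> < ennreal (\<epsilon> / 2) + ennreal (\<epsilon> / 2)"
    using tail by (simp add: ennreal_add_left_cancel_less)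
  also have "\<dots> = ennreal \<epsilon>"
    using \<open>0 < \<epsilon>\<close> by (simp flip: ennreal_plus)
  finally show ?thesis using S(1) by blast
qed

text \<open>Step approximants of \<open>f\<close> are L2-close to one another, so the isometry makes
  their values a Cauchy sequence, and completeness of the space supplies the limit.\<close>

lemma hsi_exists:
  assumes f: "f \<in> borel_measurable borel" "continuous_on {0..} f" and u: "u \<in> spectral_dom E f"
  shows "\<exists>w. hsi f u w"
proof -
  note [measurable] = f(1)
  let ?I = "\<lambda>S. \<integral>\<^sup>+ r. ennreal ((f r - step_fun S r)\<^sup>2) \<partial>\<mu> u"
  have "\<forall>n::nat. \<exists>S. is_step S \<and> ?I S < ennreal (inverse (Suc n))"
    using step_approx_continuous[OF assms] by simp
  from choice[OF this] obtain S where S: "\<And>n. is_step (S n)" "\<And>n::nat. ?I (S n) < ennreal (inverse (Suc n))"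
    by blast
  have I: "(\<lambda>n. ?I (S n)) \<longlonglongrightarrow> 0"
  proof (rule tendsto_sandwich[OF _ _ tendsto_const])
    show "(\<lambda>n. ennreal (inverse (Suc n))) \<longlonglongrightarrow> 0"
      using tendsto_ennrealI[OF LIMSEQ_inverse_real_of_nat] by simp
  qed (auto intro!: always_eventually less_imp_le S(2) simp del: of_nat_Suc)
  have norm_diff: "(norm (step_op E (S i) u - step_op E (S j) u))\<^sup>2 \<le> 2 * inverse (Suc i) + 2 * inverse (Suc j)" for i j
  proof -
    have "ennreal ((norm (step_op E (S i) u - step_op E (S j) u))\<^sup>2)
        = (\<integral>\<^sup>+ r. ennreal ((step_fun (S i) r - step_fun (S j) r)\<^sup>2) \<partial>\<mu> u)"
      by (rule hsi_nn_isometry[OF hsi_diff[OF hsi_step[OF S(1)] hsi_step[OF S(1)]], symmetric])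
    also have "\<dots> \<le> (\<integral>\<^sup>+ r. 2 * ennreal ((f r - step_fun (S i) r)\<^sup>2) + 2 * ennreal ((f r - step_fun (S j) r)\<^sup>2) \<partial>\<mu> u)"
    proof (rule nn_integral_mono)
      fix r
      have "(step_fun (S i) r - step_fun (S j) r)\<^sup>2 \<le> 2 * (f r - step_fun (S i) r)\<^sup>2 + 2 * (f r - step_fun (S j) r)\<^sup>2"
        using sum_squares_bound[of "f r - step_fun (S i) r" "- (f r - step_fun (S j) r)"]
        by (simp add: power2_eq_square algebra_simps)
      then show "ennreal ((step_fun (S i) r - step_fun (S j) r)\<^sup>2)
          \<le> 2 * ennreal ((f r - step_fun (S i) r)\<^sup>2) + 2 * ennreal ((f r - step_fun (S j) r)\<^sup>2)"
        by (simp add: ennreal_plus[symmetric] ennreal_mult[symmetric] ennreal_leI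
            flip: ennreal_numeral del: ennreal_plus)
    qed
    also have "\<dots> = 2 * ?I (S i) + 2 * ?I (S j)"
      by (subst nn_integral_add) (auto simp: nn_integral_cmult)
    also have "\<dots> \<le> 2 * ennreal (inverse (Suc i)) + 2 * ennreal (inverse (Suc j))"
      by (intro add_mono mult_left_mono less_imp_le S(2)) auto
    also have "\<dots> = ennreal (2 * inverse (Suc i) + 2 * inverse (Suc j))"
      by (simp add: ennreal_mult del: of_nat_Suc)
    finally show ?thesis
      by (subst (asm) ennreal_le_iff) (auto simp del: of_nat_Suc)
  qed
  have "Cauchy (\<lambda>n. step_op E (S n) u)"
  proof (rule metric_CauchyI)
    fix e :: real assume "0 < e"
    then obtain k :: nat where k: "inverse (real (Suc k)) < e\<^sup>2 / 4"
      using reals_Archimedean[of "e\<^sup>2 / 4"] by auto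
    have "dist (step_op E (S i) u) (step_op E (S j) u) < e" if "k \<le> i" "k \<le> j" for i j
    proof -
      have "inverse (real (Suc i)) \<le> inverse (real (Suc k))" "inverse (real (Suc j)) \<le> inverse (real (Suc k))"
        using that by (auto intro!: le_imp_inverse_le)
      then have "(norm (step_op E (S i) u - step_op E (S j) u))\<^sup>2 < e\<^sup>2"
        using norm_diff[of i j] k by linarith
      then show ?thesis
        using \<open>0 < e\<close> by (auto simp: dist_norm intro: power2_less_imp_less)
    qed
    then show "\<exists>M. \<forall>i\<ge>M. \<forall>j\<ge>M. dist (step_op E (S i) u) (step_op E (S j) u) < e"
      by blast
  qed
  then obtain w where "(\<lambda>n. step_op E (S n) u) \<longlonglongrightarrow> w"
    using Cauchy_convergent_iff convergent_def by blast
  with I S(1) f(1) show ?thesis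
    unfolding has_spectral_integral_def by blast
qed

lemma hsi_spectral_op:
  assumes "f \<in> borel_measurable borel" "continuous_on {0..} f" "u \<in> spectral_dom E f"
  shows "hsi f u (spectral_op E f u)"
proof -
  obtain w where "hsi f u w" using hsi_exists[OF assms] ..
  then show ?thesis by (simp add: spectral_op_eqI)
qed

text \<open>Existence supplies some value \<open>w\<close>, which must still be identified with
  \<open>u\<close>. The indicators of \<open>{..t}\<close> and \<open>{-1<..t}\<close> differ only
  on a null set and \<open>E (-1) u\<close> is 0, so \<open>E t w = E t u\<close> for all
  \<open>t \<ge> 0\<close>; then \<open>t\<close> tends to infinity.\<close>

lemma hsi_one: "hsi (\<lambda>_. 1) u u"
proof -
  interpret finite_measure "\<mu> u" by (rule finite_mu)
  obtain w where w: "hsi (\<lambda>_. 1) u w"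
    using hsi_exists[of "\<lambda>_. 1" u] by (auto simp: spectral_dom_def)
  have "E t w = E t u" if "0 \<le> t" for t
  proof -
    have "hsi (\<lambda>r. indicator {..t} r * 1 - step_fun [(1, -1, t)] r) u (E t w - step_op E [(1, -1, t)] u)"
      using that by (intro hsi_diff hsi_cut w hsi_step) simp
    from hsi_isometry[OF this]
    have "has_bochner_integral (\<mu> u) (\<lambda>r. (indicator {..t} r - indicator {-1<..t} r)\<^sup>2) ((norm (E t w - E t u))\<^sup>2)"
      by (simp add: step_fun_Cons step_op_Cons E_neg)
    moreover have "AE r in \<mu> u. (indicator {..t} r - indicator {-1<..t} r)\<^sup>2 = (0::real)"
      using AE_mu_nonneg by eventually_elim (simp add: indicator_def)
    then have "(\<integral>r. (indicator {..t} r - indicator {-1<..t} r)\<^sup>2 \<partial>\<mu> u) = (0::real)"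
      by (rule integral_eq_zero_AE)
    ultimately show ?thesis
      by (simp add: has_bochner_integral_iff)
  qed
  then have "\<forall>\<^sub>F t in at_top. E t w = E t u"
    by (auto intro: eventually_at_top_linorderI)
  then have "((\<lambda>t. E t u) \<longlongrightarrow> w) at_top"
    using E_at_top[of w] tendsto_cong by fast
  with E_at_top[of u] have "w = u"
    using tendsto_unique trivial_limit_at_top_linorder by blast
  with w show ?thesis by simp
qed

section \<open>Domains, norm comparison and ranges\<close>

lemma spectral_dom_bound:
  assumes g: "u \<in> spectral_dom E g" and f: "f \<in> borel_measurable borel"
    and le: "\<And>r. 0 \<le> r \<Longrightarrow> \<bar>f r\<bar> \<le> C * \<bar>g r\<bar>"
  shows "u \<in> spectral_dom E f"
proof -
  note [measurable] = f
  have "integrable (\<mu> u) (\<lambda>r. (f r)\<^sup>2)"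
  proof (rule Bochner_Integration.integrable_bound)
    show "integrable (\<mu> u) (\<lambda>r. C\<^sup>2 * (g r)\<^sup>2)"
      using g by (simp add: spectral_dom_def)
    show "AE r in \<mu> u. norm ((f r)\<^sup>2) \<le> norm (C\<^sup>2 * (g r)\<^sup>2)"
      using AE_mu_nonneg
    proof eventually_elim
      case (elim r)
      show ?case
        using power_mono[OF le[OF elim], of 2] by (simp add: power_mult_distrib)
    qed
  qed simp
  then show ?thesis by (simp add: spectral_dom_def)
qed

lemma hsi_dom: "hsi f u w \<Longrightarrow> u \<in> spectral_dom E f"
  using hsi_isometry[of f u w] by (auto simp: spectral_dom_def has_bochner_integral_iff)

text \<open>By the isometry both norms are integrals against the same measure
  \<open>\<mu> u\<close>, which lives on \<open>r \<ge> 0\<close>. The two vectors must therefore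
  arise from one common \<open>u\<close>.\<close>

lemma hsi_norm_le:
  assumes f: "hsi f u w" and g: "hsi g u z" and "0 \<le> C"
    and le: "\<And>r. 0 \<le> r \<Longrightarrow> \<bar>f r\<bar> \<le> C * \<bar>g r\<bar>"
  shows "norm w \<le> C * norm z"
proof -
  have "AE r in \<mu> u. (f r)\<^sup>2 \<le> C\<^sup>2 * (g r)\<^sup>2"
    using AE_mu_nonneg
  proof eventually_elim
    case (elim r)
    show ?case
      using power_mono[OF le[OF elim], of 2] by (simp add: power_mult_distrib)
  qed
  with hsi_isometry[OF f] hsi_isometry[OF g] have "(norm w)\<^sup>2 \<le> C\<^sup>2 * (norm z)\<^sup>2"
    using integral_mono_AE[of "\<mu> u" "\<lambda>r. (f r)\<^sup>2" "\<lambda>r. C\<^sup>2 * (g r)\<^sup>2"]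
    by (simp add: has_bochner_integral_iff)
  then show ?thesis
    using \<open>0 \<le> C\<close> by (auto simp: power_mult_distrib intro: power2_le_imp_le)
qed

lemma spectral_dom_compose:
  assumes g: "hsi g u w" and f: "f \<in> borel_measurable borel"
  shows "w \<in> spectral_dom E f \<longleftrightarrow> u \<in> spectral_dom E (\<lambda>r. f r * g r)"
proof -
  note [measurable] = f hsi_measurable[OF g]
  show ?thesis
    unfolding spectral_dom_def mem_Collect_eq mu_hsi[OF g]
    by (subst integrable_density) (auto simp: power_mult_distrib mult.commute)
qed

lemma hsi_spectral_op_compose:
  assumes "hsi g u w" "f \<in> borel_measurable borel" "continuous_on {0..} f"
    "u \<in> spectral_dom E (\<lambda>r. f r * g r)"
  shows "hsi (\<lambda>r. f r * g r) u (spectral_op E f w)"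
  by (intro hsi_compose[OF assms(1)] hsi_spectral_op assms(2,3))
    (simp add: spectral_dom_compose[OF assms(1,2)] assms(4))

text \<open>Boundedness puts every vector in the domain of \<open>f\<close>, and positivity provides
  the inverse multiplier. This turns the spaces defined as ranges of negative powers into domains of
  positive powers.\<close>

lemma range_spectral_op:
  assumes f: "f \<in> borel_measurable borel" "continuous_on {0..} f" and pos: "\<And>r. 0 < f r"
    and bdd: "\<And>r. 0 \<le> r \<Longrightarrow> f r \<le> C"
  shows "range (spectral_op E f) = spectral_dom E (\<lambda>r. inverse (f r))"
proof -
  note [measurable] = f(1)
  have one: "(\<lambda>r. inverse (f r) * f r) = (\<lambda>_. 1)" "(\<lambda>r. f r * inverse (f r)) = (\<lambda>_. 1)"
    using pos by (auto simp: fun_eq_iff less_imp_neq[THEN not_sym])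
  have dom: "v \<in> spectral_dom E f" for v
    by (rule spectral_dom_bound[OF hsi_dom[OF hsi_one]]) (use bdd pos in \<open>auto simp: abs_of_pos\<close>)
  show ?thesis
  proof (intro set_eqI iffI)
    fix u assume "u \<in> range (spectral_op E f)"
    then obtain v where "u = spectral_op E f v" by blast
    then have v: "hsi f v u"
      using hsi_spectral_op[OF f dom] by simp
    show "u \<in> spectral_dom E (\<lambda>r. inverse (f r))"
      using hsi_dom[OF hsi_one] by (subst spectral_dom_compose[OF v]) (auto simp: one)
  next
    fix u assume "u \<in> spectral_dom E (\<lambda>r. inverse (f r))"
    moreover have "continuous_on {0..} (\<lambda>r. inverse (f r))"
      using f(2) pos by (intro continuous_intros) (auto simp: less_imp_neq[THEN not_sym])
    ultimately have g: "hsi (\<lambda>r. inverse (f r)) u (spectral_op E (\<lambda>r. inverse (f r)) u)"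
      by (intro hsi_spectral_op) auto
    have "hsi (\<lambda>_. 1) u (spectral_op E f (spectral_op E (\<lambda>r. inverse (f r)) u))"
      using hsi_compose[OF g hsi_spectral_op[OF f dom]] by (simp only: one)
    then have "u = spectral_op E f (spectral_op E (\<lambda>r. inverse (f r)) u)"
      by (rule hsi_unique[OF hsi_one])
    then show "u \<in> range (spectral_op E f)" by blast
  qed
qed

end

section \<open>Bounds for the multipliers\<close>

lemma square_powr: "0 \<le> r \<Longrightarrow> r\<^sup>2 powr a = r powr (2 * a)" for r a :: real
  by (cases "r = 0") (simp_all add: powr_powr flip: powr_numeral)

lemma one_plus_powr_le:
  fixes a r :: real
  assumes "0 < a" "0 \<le> r"
  shows "1 + r powr (2 * a) \<le> 2 * (1 + r\<^sup>2) powr a"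
    and "(1 + r\<^sup>2) powr a \<le> 2 powr a * (1 + r powr (2 * a))"
proof -
  have "1 \<le> (1 + r\<^sup>2) powr a"
    using assms by (intro ge_one_powr_ge_zero) auto
  moreover have "r powr (2 * a) \<le> (1 + r\<^sup>2) powr a"
    using assms by (subst square_powr[symmetric]) (auto intro!: powr_mono2)
  ultimately show "1 + r powr (2 * a) \<le> 2 * (1 + r\<^sup>2) powr a" by simp
  show "(1 + r\<^sup>2) powr a \<le> 2 powr a * (1 + r powr (2 * a))"
  proof (cases "r \<le> 1")
    case True
    then have "(1 + r\<^sup>2) powr a \<le> 2 powr a"
      using assms power_le_one[of r 2] by (intro powr_mono2) auto
    also have "\<dots> \<le> 2 powr a * (1 + r powr (2 * a))"
      by simp
    finally show ?thesis .
  next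
    case False
    then have "(1 + r\<^sup>2) powr a \<le> (2 * r\<^sup>2) powr a"
      using assms by (intro powr_mono2) auto
    also have "\<dots> = 2 powr a * r powr (2 * a)"
      using assms by (simp add: powr_mult square_powr)
    also have "\<dots> \<le> 2 powr a * (1 + r powr (2 * a))"
      by simp
    finally show ?thesis .
  qed
qed

text \<open>A negative exponent reverses the order, so the sign of \<open>t\<close> decides which of
  the two comparisons is used; the constant must serve both.\<close>

lemma powr_le_of_comparable:
  fixes x y C t :: real
  assumes "0 < x" "0 < y" "1 \<le> C" "x \<le> C * y" "y \<le> C * x"
  shows "x powr t \<le> C powr \<bar>t\<bar> * y powr t"
proof (cases "0 \<le> t")
  case True
  then have "x powr t \<le> (C * y) powr t"
    using assms by (intro powr_mono2) auto
  then show ?thesis using True assms by (simp add: powr_mult)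
next
  case False
  then have "x powr t \<le> (y / C) powr t"
    using assms by (intro powr_mono2') (auto simp: field_simps)
  also have "\<dots> = C powr \<bar>t\<bar> * y powr t"
    using False assms by (simp add: powr_divide powr_minus_divide)
  finally show ?thesis .
qed

text \<open>\<open>1 + r powr (2 * a)\<close> and \<open>(1 + r\<^sup>2) powr a\<close> bound each
  other up to constants; raising to the power \<open>s / a\<close>, of either sign, compares the
  weights of \<open>Lam E s\<close> and \<open>Lam_pow E a (s / a)\<close>.\<close>

lemma bracket_comparable:
  fixes a s :: real
  assumes "0 < a"
  obtains C where "0 < C"
    "\<And>r. 0 \<le> r \<Longrightarrow> (1 + r\<^sup>2) powr s \<le> C * (1 + r powr (2 * a)) powr (s / a)"
    "\<And>r. 0 \<le> r \<Longrightarrow> (1 + r powr (2 * a)) powr (s / a) \<le> C * (1 + r\<^sup>2) powr s"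
proof
  \<comment> \<open>Chosen above both constants of \<open>one_plus_powr_le\<close> and above
    1.\<close>
  define B :: real where "B = 2 powr a + 2"
  have B: "1 \<le> B" "2 powr a \<le> B" "2 \<le> B"
    by (auto simp: B_def intro: order_trans[OF _ add_increasing])
  show "0 < B powr \<bar>s / a\<bar>"
    using B by simp
  fix r :: real assume r: "0 \<le> r"
  have x: "((1 + r\<^sup>2) powr a) powr (s / a) = (1 + r\<^sup>2) powr s"
    using assms by (simp add: powr_powr)
  have pos: "0 < (1 + r\<^sup>2) powr a" "0 < 1 + r powr (2 * a)"
    by (auto simp: add_pos_nonneg intro!: sum_power2_gt_zero_iff[THEN iffD2])
      (metis add_nonneg_eq_0_iff zero_le_one zero_le_power2 zero_neq_one)
  have le: "(1 + r\<^sup>2) powr a \<le> B * (1 + r powr (2 * a))" "1 + r powr (2 * a) \<le> B * (1 + r\<^sup>2) powr a"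
    using one_plus_powr_le[OF assms r] B pos
      mult_right_mono[OF B(2), of "1 + r powr (2 * a)"] mult_right_mono[OF B(3), of "(1 + r\<^sup>2) powr a"]
    by linarith+
  show "(1 + r\<^sup>2) powr s \<le> B powr \<bar>s / a\<bar> * (1 + r powr (2 * a)) powr (s / a)"
    using powr_le_of_comparable[OF pos(1,2) B(1) le, of "s / a"] by (simp only: x)
  show "(1 + r powr (2 * a)) powr (s / a) \<le> B powr \<bar>s / a\<bar> * (1 + r\<^sup>2) powr s"
    using powr_le_of_comparable[OF pos(2,1) B(1) le(2,1), of "s / a"] by (simp only: x)
qed

text \<open>Like \<open>s - 1\<close>, the function \<open>s powr a - 1\<close> has a simple zero at
  1. The limit 4 is the value of \<open>(r / t)\<^sup>2\<close> at the cut; some limit is required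
  for \<open>a < 1\<close>, when \<open>s powr a\<close> grows more slowly than
  \<open>s\<close>.\<close>

lemma abs_diff_one_le_powr:
  fixes a :: real
  assumes "0 < a"
  obtains C where "0 < C" "\<And>s. \<lbrakk>0 \<le> s; s \<le> 4\<rbrakk> \<Longrightarrow> \<bar>s - 1\<bar> \<le> C * \<bar>s powr a - 1\<bar>"
proof (cases "1 \<le> a")
  case True
  have "\<bar>s - 1\<bar> \<le> 1 * \<bar>s powr a - 1\<bar>" if "0 \<le> s" for s :: real
  proof (cases "1 \<le> s")
    case s: True
    then have "s powr 1 \<le> s powr a" using True by (intro powr_mono) auto
    with s show ?thesis by simp
  next
    case s: False
    then have "s powr a \<le> s powr 1" using True that by (intro powr_mono') auto
    with s that show ?thesis by simp
  qed
  then show ?thesis by (intro that[of 1]) auto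
next
  case False
  \<comment> \<open>The derivative of \<open>s powr a\<close> at 4. For \<open>a < 1\<close> the
    derivative decreases, so this is its minimum up to 4.\<close>
  define c where "c = a * 4 powr (a - 1)"
  have c: "0 < c" using assms by (simp add: c_def)
  have "(4::real) powr (a - 1) \<le> 4 powr 0"
    using False by (intro powr_mono) auto
  \<comment> \<open>Covers \<open>s = 0\<close>, which the mean value bound below excludes by
    requiring a positive left endpoint.\<close>
  then have "c \<le> 1 * 1"
    unfolding c_def using assms False by (intro mult_mono) auto
  have mvt: "c * (y - x) \<le> y powr a - x powr a" if xy: "0 < x" "x < y" "y \<le> 4" for x y :: real
  proof -
    have "\<exists>z>x. z < y \<and> y powr a - x powr a = (y - x) * (a * z powr (a - 1))"
      using xy by (intro MVT2) (auto intro!: derivative_eq_intros)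
    then obtain z where z: "x < z" "z < y" "y powr a - x powr a = (y - x) * (a * z powr (a - 1))"
      by blast
    have "4 powr (a - 1) \<le> z powr (a - 1)"
      using z xy False by (intro powr_mono2') auto
    then have "(y - x) * c \<le> (y - x) * (a * z powr (a - 1))"
      unfolding c_def using xy assms by (intro mult_left_mono) auto
    with z(3) show ?thesis by (simp add: mult.commute)
  qed
  have "\<bar>s - 1\<bar> \<le> (1 / c) * \<bar>s powr a - 1\<bar>" if s: "0 \<le> s" "s \<le> 4" for s :: real
  proof -
    have "c * \<bar>s - 1\<bar> \<le> \<bar>s powr a - 1\<bar>"
    proof -
      consider "s = 0" | "0 < s" "s < 1" | "s = 1" | "1 < s" using s by linarith
      then show ?thesis
      proof cases
        case 2
        then have "c * \<bar>s - 1\<bar> = c * (1 - s)" by simp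
        also have "\<dots> \<le> 1 - s powr a" using mvt[of s 1] 2 by simp
        finally show ?thesis by linarith
      next
        case 4
        then have "c * \<bar>s - 1\<bar> = c * (s - 1)" by simp
        also have "\<dots> \<le> s powr a - 1" using mvt[of 1 s] 4 s by simp
        finally show ?thesis by linarith
      qed (use \<open>c \<le> 1 * 1\<close> in auto)
    qed
    with c show ?thesis by (simp add: field_simps)
  qed
  with c show ?thesis by (intro that[of "1 / c"]) auto
qed

text \<open>Homogeneity: with \<open>s = (r / t)\<^sup>2\<close> between 0 and 4, the symbols become
  \<open>t\<^sup>2 * (s - 1)\<close> and \<open>t powr (2 * a) * (s powr a - 1)\<close>, and the
  quotient of the prefactors is \<open>t powr (2 - 2 * a)\<close>.\<close>

lemma low_frequency_symbol_bound:
  fixes a :: real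
  assumes "0 < a"
  obtains C where "0 < C"
    "\<And>r t. \<lbrakk>0 < t; 0 \<le> r; r \<le> 2 * t\<rbrakk> \<Longrightarrow>
      \<bar>r\<^sup>2 - t\<^sup>2\<bar> \<le> C * t powr (2 - 2 * a) * \<bar>r powr (2 * a) - t powr (2 * a)\<bar>"
proof -
  obtain C where C: "0 < C" "\<And>s. \<lbrakk>0 \<le> s; s \<le> 4\<rbrakk> \<Longrightarrow> \<bar>s - 1\<bar> \<le> C * \<bar>s powr a - 1\<bar>"
    using abs_diff_one_le_powr[OF assms] by blast
  have "\<bar>r\<^sup>2 - t\<^sup>2\<bar> \<le> C * t powr (2 - 2 * a) * \<bar>r powr (2 * a) - t powr (2 * a)\<bar>"
    if t: "0 < t" and r: "0 \<le> r" "r \<le> 2 * t" for r t :: real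
  proof -
    have "r\<^sup>2 \<le> (2 * t)\<^sup>2"
      using r by (intro power_mono)
    then have s: "0 \<le> (r / t)\<^sup>2" "(r / t)\<^sup>2 \<le> 4"
      using t by (auto simp: power_divide field_simps power_mult_distrib)
    have "(r / t)\<^sup>2 powr a = (r / t) powr (2 * a)"
      using r t by (simp add: square_powr)
    also have "\<dots> = r powr (2 * a) / t powr (2 * a)"
      using r t by (simp add: powr_divide)
    finally have e: "(r / t)\<^sup>2 powr a - 1 = (r powr (2 * a) - t powr (2 * a)) / t powr (2 * a)"
      using t by (simp add: field_simps)
    have "r\<^sup>2 - t\<^sup>2 = t\<^sup>2 * ((r / t)\<^sup>2 - 1)"
      using t by (simp add: power_divide right_diff_distrib)
    then have "\<bar>r\<^sup>2 - t\<^sup>2\<bar> = t\<^sup>2 * \<bar>(r / t)\<^sup>2 - 1\<bar>"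
      by (simp add: abs_mult)
    also have "\<dots> \<le> t\<^sup>2 * (C * \<bar>(r / t)\<^sup>2 powr a - 1\<bar>)"
      by (intro mult_left_mono C(2) s) auto
    also have "\<dots> = C * (t\<^sup>2 / t powr (2 * a)) * \<bar>r powr (2 * a) - t powr (2 * a)\<bar>"
      unfolding e by (simp add: abs_divide)
    also have "t\<^sup>2 / t powr (2 * a) = t powr (2 - 2 * a)"
      using t by (simp add: powr_diff)
    finally show ?thesis .
  qed
  with C(1) show ?thesis by (rule that)
qed

text \<open>For \<open>r\<close> beyond \<open>2 * t\<close>, the term \<open>t powr (2 * a)\<close>
  is at most a fixed fraction \<open>q < 1\<close> of \<open>r powr (2 * a)\<close>, so the
  difference keeps the proportion \<open>1 - q\<close>. Since \<open>1 \<le> t\<close>, the summand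
  1 is absorbed as well; hence the factor 2.\<close>

lemma high_frequency_symbol_bound:
  fixes a :: real
  assumes "0 < a"
  obtains C where "0 < C"
    "\<And>r t. \<lbrakk>1 \<le> t; 2 * t < r\<rbrakk> \<Longrightarrow> 1 + r powr (2 * a) \<le> C * \<bar>r powr (2 * a) - t powr (2 * a)\<bar>"
proof -
  define q :: real where "q = 2 powr (- (2 * a))"
  have "q < 1"
    using powr_less_mono[of "- (2 * a)" 0 "2::real"] assms by (simp add: q_def)
  have "1 + r powr (2 * a) \<le> 2 / (1 - q) * \<bar>r powr (2 * a) - t powr (2 * a)\<bar>"
    if t: "1 \<le> t" "2 * t < r" for r t :: real
  proof -
    have "t powr (2 * a) \<le> (r / 2) powr (2 * a)"
      using t assms by (intro powr_mono2) auto
    also have "\<dots> = q * r powr (2 * a)"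
      using t by (simp add: q_def powr_divide powr_minus_divide)
    finally have "(1 - q) * r powr (2 * a) \<le> \<bar>r powr (2 * a) - t powr (2 * a)\<bar>"
      by (simp add: algebra_simps)
    then have "r powr (2 * a) \<le> \<bar>r powr (2 * a) - t powr (2 * a)\<bar> / (1 - q)"
      using \<open>q < 1\<close> by (simp add: field_simps)
    moreover have "1 \<le> r powr (2 * a)"
      using t assms by (intro ge_one_powr_ge_zero) auto
    ultimately show ?thesis
      by simp
  qed
  with \<open>q < 1\<close> show ?thesis by (intro that[of "2 / (1 - q)"]) auto
qed

section \<open>Positivity and continuity of the weights\<close>

lemma one_plus_power2_pos: "0 < 1 + (r::real)\<^sup>2"
  by (simp add: add_pos_nonneg)

lemma continuous_on_bracket: "continuous_on X (\<lambda>r::real. (1 + r\<^sup>2) powr s)"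
  using one_plus_power2_pos by (intro continuous_intros) (auto simp: less_imp_neq[THEN not_sym])

lemma continuous_on_nonneg_powr: "0 < a \<Longrightarrow> continuous_on {0..} (\<lambda>r::real. r powr a)"
  by (rule continuous_on_powr') (auto intro!: continuous_intros)

lemma one_plus_powr_pos: "0 < 1 + (r::real) powr a"
  by (simp add: add_pos_nonneg)

lemma continuous_on_bracket_powr: "0 < a \<Longrightarrow> continuous_on {0..} (\<lambda>r::real. (1 + r powr a) powr s)"
  using one_plus_powr_pos[of _ a]
  by (intro continuous_on_powr continuous_on_add continuous_on_nonneg_powr continuous_on_const)
    (auto simp: less_imp_neq[THEN not_sym])

section \<open>Splitting at frequency \<open>2\<tau>\<close>\<close>

context half_line_spectral_family
begin

lemma Hs_eq:
  assumes "0 \<le> s"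
  shows "Hs E s = spectral_dom E (\<lambda>r. (1 + r\<^sup>2) powr s)"
proof -
  have "(1 + r\<^sup>2) powr - s \<le> 1" for r :: real
    using powr_mono[of "- s" 0 "1 + r\<^sup>2"] assms one_plus_power2_pos[of r] by simp
  then have "range (spectral_op E (\<lambda>r. (1 + r\<^sup>2) powr - s)) =
      spectral_dom E (\<lambda>r. inverse ((1 + r\<^sup>2) powr - s))"
    using one_plus_power2_pos
    by (intro range_spectral_op[where C=1] continuous_on_bracket) (auto simp: less_imp_neq[THEN not_sym])
  then show ?thesis
    by (simp add: Hs_def Lam_def powr_minus)
qed

lemma Hs_pow_eq:
  assumes "0 < a" "0 \<le> s"
  shows "Hs_pow E a s = spectral_dom E (\<lambda>r. (1 + r powr (2 * a)) powr s)"
proof -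
  have "(1 + r powr (2 * a)) powr - s \<le> 1" for r
    using powr_mono[of "- s" 0 "1 + r powr (2 * a)"] assms one_plus_powr_pos[of r "2 * a"] by simp
  then have "range (spectral_op E (\<lambda>r. (1 + r powr (2 * a)) powr - s)) =
      spectral_dom E (\<lambda>r. inverse ((1 + r powr (2 * a)) powr - s))"
    using assms one_plus_powr_pos[of _ "2 * a"]
    by (intro range_spectral_op[where C=1] continuous_on_bracket_powr) (auto simp: less_imp_neq[THEN not_sym])
  then show ?thesis
    by (simp add: Hs_pow_def Lam_pow_def powr_minus)
qed

text \<open>A continuous \<open>g\<close> is bounded on \<open>{0..t}\<close>, the only part of the
  half line that a truncated vector sees. This makes the test vector admissible for all powers at
  once.\<close>

lemma E_in_dom_continuous:
  assumes "g \<in> borel_measurable borel" "continuous_on {0..} g"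
  shows "E t w \<in> spectral_dom E g"
proof -
  have cut: "hsi (\<lambda>r. indicator {..t} r * 1) w (E t w)"
    by (rule hsi_cut[OF hsi_one])
  have "compact (g ` {0..t})"
    by (intro compact_continuous_image continuous_on_subset[OF assms(2)]) auto
  then obtain B where B: "\<And>r. r \<in> {0..t} \<Longrightarrow> \<bar>g r\<bar> \<le> B"
    by (fastforce dest!: compact_imp_bounded simp: bounded_iff)
  have "w \<in> spectral_dom E (\<lambda>r. g r * (indicator {..t} r * 1))"
  proof (rule spectral_dom_bound[where C="\<bar>B\<bar>", OF hsi_dom[OF hsi_one]])
    show "\<bar>g r * (indicator {..t} r * 1)\<bar> \<le> \<bar>B\<bar> * \<bar>1\<bar>" if "0 \<le> r" for r
      using B[of r] that by (auto simp: indicator_def)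
  qed (use assms(1) in measurable)
  then show ?thesis
    by (simp only: spectral_dom_compose[OF cut assms(1)])
qed

text \<open>
  The estimate for \<open>P\<close> is applied to \<open>v = E(2\<tau>) \<Lambda>\<^sup>-\<^sup>\<nu> \<Lambda>\<^sub>(\<^sub>\<alpha>\<^sub>)\<^sup>\<nu>\<^sup>/\<^sup>\<alpha> u\<close>, for which \<open>\<Lambda>\<^sup>\<nu> v\<close> is the low frequency
  part of \<open>\<Lambda>\<^sub>(\<^sub>\<alpha>\<^sub>)\<^sup>\<nu>\<^sup>/\<^sup>\<alpha> u\<close>. All vectors in the proof are of the form \<open>f(P) u\<close> for this one \<open>u\<close>, so every
  estimate between them is a pointwise estimate between multipliers \<open>f\<close>.
\<close>

lemma frequency_splitting:
  fixes \<gamma> \<nu> \<alpha> N K :: real and Q :: "'h \<Rightarrow> 'y::real_normed_vector"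
  assumes \<alpha>: "0 < \<alpha>" "2 * \<gamma> \<le> \<alpha>" and \<gamma>: "0 \<le> \<gamma>" "\<gamma> \<le> 1 / 2" and \<nu>: "0 \<le> \<nu>" and N: "0 < N" and K: "0 \<le> K"
    and Q_lin: "linear_op_on (Hs E \<gamma>) Q"
    and Q_bdd: "\<And>u. u \<in> Hs E \<gamma> \<Longrightarrow> norm (Q u) \<le> K * norm (Lam E \<gamma> u)"
  obtains C where "0 < C"
    "\<And>\<tau> M m e u. \<lbrakk>1 \<le> \<tau>; 0 \<le> M; 0 \<le> m; 0 \<le> e; u \<in> Hs_pow E \<alpha> (1 + (\<nu> - \<gamma>) / \<alpha>);
      \<And>v. \<lbrakk>v \<in> Hs E (1 + \<nu> - \<gamma>); Lam E (\<nu> - \<gamma>) v \<in> spectral_dom E (\<lambda>r. r\<^sup>2)\<rbrakk> \<Longrightarrow>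
        norm v \<le> M * norm (spectral_op E (\<lambda>r. r\<^sup>2) (Lam E (\<nu> - \<gamma>) v) - \<tau>\<^sup>2 *\<^sub>R Lam E (\<nu> - \<gamma>) v)
          + m * norm (Q (Lam E \<nu> v)) + e * norm (Lam E (- N) v)\<rbrakk> \<Longrightarrow>
      norm u \<le> C * ((M * \<tau> powr (2 - 2 * \<alpha>) + (m + 1) * \<tau> powr (4 * \<gamma> - 2 * \<alpha>)) *
          norm (P_pow E \<alpha> (Lam_pow E \<alpha> ((\<nu> - \<gamma>) / \<alpha>) u) - \<tau> powr (2 * \<alpha>) *\<^sub>R Lam_pow E \<alpha> ((\<nu> - \<gamma>) / \<alpha>) u)
        + m * norm (Q (Lam_pow E \<alpha> (\<nu> / \<alpha>) u)) + e * norm (Lam_pow E \<alpha> (- N / \<alpha>) u))"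
proof -
  define L where "L s r = (1 + r\<^sup>2) powr s" for s r :: real
  define A where "A s r = (1 + r powr (2 * \<alpha>)) powr s" for s r :: real
  have L_meas [measurable]: "L s \<in> borel_measurable borel" for s
    unfolding L_def by measurable
  have A_meas [measurable]: "A s \<in> borel_measurable borel" for s
    unfolding A_def by measurable
  have L_cont: "continuous_on {0..} (L s)" for s
    unfolding L_def by (rule continuous_on_bracket)
  have A_cont: "continuous_on {0..} (A s)" for s
    unfolding A_def using \<alpha> by (intro continuous_on_bracket_powr) simp
  have L_pos: "0 < L s r" for s r
    using one_plus_power2_pos[of r] by (simp add: L_def)
  have A_pos: "0 < A s r" for s r
    using one_plus_powr_pos[of r "2 * \<alpha>"] by (simp add: A_def)
  have L_add: "L s r * L t r = L (s + t) r" for s t r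
    by (simp add: L_def powr_add)
  have A_add: "A s r * A t r = A (s + t) r" for s t r
    by (simp add: A_def powr_add)
  have A_mono: "A s r \<le> A t r" if "s \<le> t" for s t r
    using that by (auto simp: A_def intro!: powr_mono)
  have L_0: "L 0 r = 1" and A_0: "A 0 r = 1" for r
    using one_plus_power2_pos[of r] one_plus_powr_pos[of r "2 * \<alpha>"] by (simp_all add: L_def A_def)
  have Lam: "Lam E s = spectral_op E (L s)" for s
    by (simp add: Lam_def L_def[abs_def])
  have Lam_pow: "Lam_pow E \<alpha> s = spectral_op E (A s)" for s
    by (simp add: Lam_pow_def A_def[abs_def])
  have comparable: "\<exists>C>0. \<forall>r\<ge>0. L s r \<le> C * A (s / \<alpha>) r \<and> A (s / \<alpha>) r \<le> C * L s r" for s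
    using bracket_comparable[OF \<alpha>(1), of s] unfolding L_def A_def by metis
  obtain C1 where C1: "0 < C1" "\<And>r. 0 \<le> r \<Longrightarrow> L \<gamma> r \<le> C1 * A (\<gamma> / \<alpha>) r"
    using comparable[of \<gamma>] by blast
  obtain C2 where C2: "0 < C2" "\<And>r. 0 \<le> r \<Longrightarrow> L (- \<gamma>) r \<le> C2 * A (- \<gamma> / \<alpha>) r"
    using comparable[of "- \<gamma>"] by blast
  obtain C3 where C3: "0 < C3" "\<And>r. 0 \<le> r \<Longrightarrow> L \<nu> r \<le> C3 * A (\<nu> / \<alpha>) r"
      "\<And>r. 0 \<le> r \<Longrightarrow> A (\<nu> / \<alpha>) r \<le> C3 * L \<nu> r"
    using comparable[of \<nu>] by blast
  obtain C4 where C4: "0 < C4" "\<And>r. 0 \<le> r \<Longrightarrow> L (- N) r \<le> C4 * A (- N / \<alpha>) r"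
    using comparable[of "- N"] by blast
  obtain C5 where C5: "0 < C5" "\<And>r t. \<lbrakk>0 < t; 0 \<le> r; r \<le> 2 * t\<rbrakk> \<Longrightarrow>
      \<bar>r\<^sup>2 - t\<^sup>2\<bar> \<le> C5 * t powr (2 - 2 * \<alpha>) * \<bar>r powr (2 * \<alpha>) - t powr (2 * \<alpha>)\<bar>"
    using low_frequency_symbol_bound[OF \<alpha>(1)] by blast
  obtain C6 where C6: "0 < C6" "\<And>r t. \<lbrakk>1 \<le> t; 2 * t < r\<rbrakk> \<Longrightarrow>
      1 + r powr (2 * \<alpha>) \<le> C6 * \<bar>r powr (2 * \<alpha>) - t powr (2 * \<alpha>)\<bar>"
    using high_frequency_symbol_bound[OF \<alpha>(1)] by blast
  \<comment> \<open>The summands are the coefficients of \<open>M * T1\<close>,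
    \<open>m * T2\<close>, \<open>T2\<close>, \<open>m * norm (Q q)\<close> and
    \<open>e * norm n\<close> in the closing computation, in this order.\<close>
  define C where "C = C3 * C2 * C5 + C3 * K * C1 * C6 + C6 + C3 + C3 * C4 * C3"
  have C_ge: "C3 * C2 * C5 \<le> C" "C3 * K * C1 * C6 \<le> C" "C6 + C3 * K * C1 * C6 \<le> C" "C6 \<le> C" "C3 \<le> C" "C3 * C4 * C3 \<le> C" "0 < C"
    using C1(1) C2(1) C3(1) C4(1) C5(1) C6(1) K
    by (auto simp: C_def intro!: add_nonneg_nonneg add_pos_nonneg add_increasing mult_nonneg_nonneg)
  show ?thesis
  proof (rule that[OF C_ge(7)])
    fix \<tau> M m e :: real and u :: 'h
    assume \<tau>: "1 \<le> \<tau>" and nonneg: "0 \<le> M" "0 \<le> m" "0 \<le> e"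
      and u: "u \<in> Hs_pow E \<alpha> (1 + (\<nu> - \<gamma>) / \<alpha>)"
      and est: "\<And>v. \<lbrakk>v \<in> Hs E (1 + \<nu> - \<gamma>); Lam E (\<nu> - \<gamma>) v \<in> spectral_dom E (\<lambda>r. r\<^sup>2)\<rbrakk> \<Longrightarrow>
        norm v \<le> M * norm (spectral_op E (\<lambda>r. r\<^sup>2) (Lam E (\<nu> - \<gamma>) v) - \<tau>\<^sup>2 *\<^sub>R Lam E (\<nu> - \<gamma>) v)
          + m * norm (Q (Lam E \<nu> v)) + e * norm (Lam E (- N) v)"
    \<comment> \<open>\<open>A p\<close> is the weight whose domain contains \<open>u\<close> by
      assumption. The bound \<open>\<gamma> / \<alpha> + \<nu> / \<alpha> \<le> p\<close> proved
      next is \<open>2 * \<gamma> \<le> \<alpha>\<close> in disguise; it will place the observed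
      vector in \<open>Hs E \<gamma>\<close>.\<close>
    define p where "p = 1 + (\<nu> - \<gamma>) / \<alpha>"
    have "2 * (\<gamma> / \<alpha>) \<le> 1"
      using \<alpha> by simp
    moreover have "0 \<le> \<gamma> / \<alpha>" "0 \<le> \<nu> / \<alpha>" "0 \<le> N / \<alpha>"
      using \<alpha> \<gamma> \<nu> N by simp_all
    ultimately have p: "0 \<le> p" "\<gamma> / \<alpha> + \<nu> / \<alpha> \<le> p" "\<nu> / \<alpha> \<le> p" "(\<nu> - \<gamma>) / \<alpha> \<le> p" "- N / \<alpha> \<le> p" "0 \<le> \<nu> / \<alpha> + \<gamma> / \<alpha>"
      unfolding p_def diff_divide_distrib minus_divide_left[symmetric] by linarith+
    have u_dom: "u \<in> spectral_dom E (A p)"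
      using u \<alpha>(1) p(1) unfolding p_def[symmetric] by (simp add: Hs_pow_eq A_def[abs_def])
    have dom: "u \<in> spectral_dom E f" if "f \<in> borel_measurable borel" "\<And>r. 0 \<le> r \<Longrightarrow> \<bar>f r\<bar> \<le> B * A p r" for f B
      by (rule spectral_dom_bound[OF u_dom that(1)]) (use that(2) A_pos[of p] in \<open>auto simp: abs_of_pos\<close>)
    have A_hsi: "hsi (A s) u (Lam_pow E \<alpha> s u)" if "s \<le> p" for s
      unfolding Lam_pow
      by (rule hsi_spectral_op[OF A_meas A_cont], rule dom[where B=1]) (use A_mono[OF that] A_pos[of s] in \<open>auto simp: abs_of_pos\<close>)
    define w where "w = Lam_pow E \<alpha> ((\<nu> - \<gamma>) / \<alpha>) u"
    define q where "q = Lam_pow E \<alpha> (\<nu> / \<alpha>) u"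
    have w: "hsi (A ((\<nu> - \<gamma>) / \<alpha>)) u w" and q: "hsi (A (\<nu> / \<alpha>)) u q"
      unfolding w_def q_def using p by (auto intro: A_hsi)
    have pow_cont: "continuous_on {0..} (\<lambda>r::real. r powr (2 * \<alpha>))"
      using \<alpha>(1) by (intro continuous_on_nonneg_powr) simp
    have pow_meas: "(\<lambda>r::real. r powr (2 * \<alpha>)) \<in> borel_measurable borel"
      by measurable
    have Pw: "hsi (\<lambda>r. r powr (2 * \<alpha>) * A ((\<nu> - \<gamma>) / \<alpha>) r) u (P_pow E \<alpha> w)"
      unfolding P_pow_def
    proof (rule hsi_spectral_op_compose[OF w pow_meas pow_cont], rule dom[where B=1])
      fix r :: real
      have "r powr (2 * \<alpha>) \<le> A 1 r"
        by (simp add: A_def add_nonneg_nonneg)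
      then have "r powr (2 * \<alpha>) * A ((\<nu> - \<gamma>) / \<alpha>) r \<le> A 1 r * A ((\<nu> - \<gamma>) / \<alpha>) r"
        using A_pos[of "(\<nu> - \<gamma>) / \<alpha>" r] by (intro mult_right_mono) auto
      then show "\<bar>r powr (2 * \<alpha>) * A ((\<nu> - \<gamma>) / \<alpha>) r\<bar> \<le> 1 * A p r"
        using A_pos[of "(\<nu> - \<gamma>) / \<alpha>" r] by (simp add: A_add p_def abs_mult abs_of_pos)
    qed measurable
    define R where "R = P_pow E \<alpha> w - \<tau> powr (2 * \<alpha>) *\<^sub>R w"
    define \<phi> where "\<phi> r = (r powr (2 * \<alpha>) - \<tau> powr (2 * \<alpha>)) * A ((\<nu> - \<gamma>) / \<alpha>) r" for r
    have R: "hsi \<phi> u R"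
      using hsi_diff[OF Pw hsi_scale[OF w, of "\<tau> powr (2 * \<alpha>)"]]
      unfolding R_def \<phi>_def[abs_def] by (simp add: left_diff_distrib)
    have \<phi>_abs: "\<bar>\<phi> r\<bar> = \<bar>r powr (2 * \<alpha>) - \<tau> powr (2 * \<alpha>)\<bar> * A ((\<nu> - \<gamma>) / \<alpha>) r" for r
      using A_pos by (simp add: \<phi>_def abs_mult abs_of_pos)
    \<comment> \<open>The exponent is split as \<open>(2 * \<gamma> / \<alpha> - 1) + 1 + (\<nu> -
      \<gamma>) / \<alpha>\<close>: the nonpositive part yields the power of \<open>\<tau>\<close>,
      the 1 is absorbed by ellipticity, and the rest is the weight inside
      \<open>\<phi>\<close>.\<close>
    have high: "A (\<gamma> / \<alpha> + \<nu> / \<alpha>) r \<le> C6 * \<tau> powr (4 * \<gamma> - 2 * \<alpha>) * \<bar>\<phi> r\<bar>" if r: "2 * \<tau> < r" for r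
    proof -
      have "A (2 * \<gamma> / \<alpha> - 1) r \<le> (\<tau> powr (2 * \<alpha>)) powr (2 * \<gamma> / \<alpha> - 1)"
        unfolding A_def
      proof (rule powr_mono2')
        have "\<tau> powr (2 * \<alpha>) \<le> r powr (2 * \<alpha>)"
          using r \<tau> \<alpha> by (intro powr_mono2) auto
        then show "\<tau> powr (2 * \<alpha>) \<le> 1 + r powr (2 * \<alpha>)" by simp
      qed (use \<alpha> \<tau> in auto)
      also have "\<dots> = \<tau> powr (4 * \<gamma> - 2 * \<alpha>)"
        using \<alpha> by (simp add: powr_powr right_diff_distrib)
      finally have 1: "A (2 * \<gamma> / \<alpha> - 1) r \<le> \<tau> powr (4 * \<gamma> - 2 * \<alpha>)" .
      have "A 1 r \<le> C6 * \<bar>r powr (2 * \<alpha>) - \<tau> powr (2 * \<alpha>)\<bar>"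
        using C6(2)[OF \<tau> r] by (simp add: A_def add_nonneg_nonneg)
      then have "A (2 * \<gamma> / \<alpha> - 1) r * A 1 r \<le> \<tau> powr (4 * \<gamma> - 2 * \<alpha>) * (C6 * \<bar>r powr (2 * \<alpha>) - \<tau> powr (2 * \<alpha>)\<bar>)"
        using A_pos[of 1 r] by (intro mult_mono 1) auto
      then have "A (2 * \<gamma> / \<alpha> - 1) r * A 1 r * A ((\<nu> - \<gamma>) / \<alpha>) r
          \<le> \<tau> powr (4 * \<gamma> - 2 * \<alpha>) * (C6 * \<bar>r powr (2 * \<alpha>) - \<tau> powr (2 * \<alpha>)\<bar>) * A ((\<nu> - \<gamma>) / \<alpha>) r"
        using A_pos[of "(\<nu> - \<gamma>) / \<alpha>" r] by (intro mult_right_mono) auto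
      also have "A (2 * \<gamma> / \<alpha> - 1) r * A 1 r * A ((\<nu> - \<gamma>) / \<alpha>) r = A (\<gamma> / \<alpha> + \<nu> / \<alpha>) r"
        by (simp add: A_add) (simp add: diff_divide_distrib)
      finally show ?thesis
        by (simp add: \<phi>_abs mult_ac)
    qed
    define v where "v = E (2 * \<tau>) (spectral_op E (L (- \<nu>)) q)"
    define k where "k r = indicator {..2 * \<tau>} r * (L (- \<nu>) r * A (\<nu> / \<alpha>) r)" for r :: real
    \<comment> \<open>Apart from the cutoff, the multiplier of \<open>v\<close> lies between
      \<open>1 / C3\<close> and \<open>C3\<close>, so replacing the low frequencies of
      \<open>u\<close> by \<open>v\<close> loses only constants.\<close>
    have h_le: "L (- \<nu>) r * A (\<nu> / \<alpha>) r \<le> C3" "1 \<le> C3 * (L (- \<nu>) r * A (\<nu> / \<alpha>) r)" if "0 \<le> r" for r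
    proof -
      have "L (- \<nu>) r * A (\<nu> / \<alpha>) r \<le> L (- \<nu>) r * (C3 * L \<nu> r)"
        using L_pos[of "- \<nu>" r] C3(3)[OF that] by (intro mult_left_mono) auto
      also have "\<dots> = C3 * (L (- \<nu>) r * L \<nu> r)" by simp
      finally show "L (- \<nu>) r * A (\<nu> / \<alpha>) r \<le> C3" by (simp add: L_add L_0)
      have "L (- \<nu>) r * L \<nu> r \<le> L (- \<nu>) r * (C3 * A (\<nu> / \<alpha>) r)"
        using L_pos[of "- \<nu>" r] C3(2)[OF that] by (intro mult_left_mono) auto
      then show "1 \<le> C3 * (L (- \<nu>) r * A (\<nu> / \<alpha>) r)" by (simp add: L_add L_0 mult_ac)
    qed
    have "hsi (\<lambda>r. L (- \<nu>) r * A (\<nu> / \<alpha>) r) u (spectral_op E (L (- \<nu>)) q)"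
    proof (rule hsi_spectral_op_compose[OF q L_meas L_cont], rule dom[where B=C3])
      fix r :: real assume r: "0 \<le> r"
      have "C3 * 1 \<le> C3 * A p r"
        using C3(1) A_mono[OF p(1), of r] by (intro mult_left_mono) (auto simp: A_0)
      then show "\<bar>L (- \<nu>) r * A (\<nu> / \<alpha>) r\<bar> \<le> C3 * A p r"
        using h_le(1)[OF r] L_pos[of "- \<nu>" r] A_pos[of "\<nu> / \<alpha>" r] by (simp add: abs_mult)
    qed measurable
    then have v: "hsi k u v"
      unfolding v_def k_def[abs_def] by (rule hsi_cut)
    have v_dom: "v \<in> spectral_dom E g" if "g \<in> borel_measurable borel" "continuous_on {0..} g" for g
      unfolding v_def by (rule E_in_dom_continuous[OF that])
    have op_v: "hsi (\<lambda>r. g r * k r) u (spectral_op E g v)" if "g \<in> borel_measurable borel" "continuous_on {0..} g" for g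
      by (rule hsi_compose[OF v hsi_spectral_op[OF that v_dom[OF that]]])
    have Lv: "hsi (\<lambda>r. L s r * k r) u (Lam E s v)" for s
      unfolding Lam by (rule op_v[OF L_meas L_cont])
    have sq: "(\<lambda>r::real. r\<^sup>2) \<in> borel_measurable borel" "continuous_on {0..} (\<lambda>r::real. r\<^sup>2)"
      by (auto intro!: continuous_intros)
    have Lv_dom: "Lam E (\<nu> - \<gamma>) v \<in> spectral_dom E (\<lambda>r. r\<^sup>2)"
      unfolding Lam
      by (subst spectral_dom_compose[OF hsi_spectral_op[OF L_meas L_cont v_dom[OF L_meas L_cont]] sq(1)])
        (intro v_dom borel_measurable_times sq L_meas continuous_on_mult L_cont)
    have v_Hs: "v \<in> Hs E (1 + \<nu> - \<gamma>)"
      using \<gamma> \<nu> v_dom[OF L_meas L_cont] by (simp add: Hs_eq L_def[abs_def])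
    define a where "a = Lam E (\<nu> - \<gamma>) v"
    have a: "hsi (\<lambda>r. L (\<nu> - \<gamma>) r * k r) u a"
      unfolding a_def by (rule Lv)
    have "hsi (\<lambda>r. r\<^sup>2 * (L (\<nu> - \<gamma>) r * k r) - \<tau>\<^sup>2 * (L (\<nu> - \<gamma>) r * k r)) u
        (spectral_op E (\<lambda>r. r\<^sup>2) a - \<tau>\<^sup>2 *\<^sub>R a)"
      by (intro hsi_diff hsi_scale a hsi_compose[OF a hsi_spectral_op[OF sq]])
        (simp add: a_def Lv_dom)
    \<comment> \<open>Below the cut, \<open>L (\<nu> - \<gamma>)\<close> and
      \<open>L (- \<nu>)\<close> combine to \<open>L (- \<gamma>)\<close>; trading this for
      \<open>A (- \<gamma> / \<alpha>)\<close> restores the weight of \<open>\<phi>\<close>, and the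
      symbols are compared by \<open>C5\<close>.\<close>
    then have B1: "norm (spectral_op E (\<lambda>r. r\<^sup>2) a - \<tau>\<^sup>2 *\<^sub>R a) \<le> C2 * C5 * \<tau> powr (2 - 2 * \<alpha>) * norm R"
    proof (rule hsi_norm_le[OF _ R])
      show "0 \<le> C2 * C5 * \<tau> powr (2 - 2 * \<alpha>)"
        using C2(1) C5(1) by simp
      fix r :: real assume r: "0 \<le> r"
      show "\<bar>r\<^sup>2 * (L (\<nu> - \<gamma>) r * k r) - \<tau>\<^sup>2 * (L (\<nu> - \<gamma>) r * k r)\<bar> \<le> C2 * C5 * \<tau> powr (2 - 2 * \<alpha>) * \<bar>\<phi> r\<bar>"
      proof (cases "r \<le> 2 * \<tau>")
        case True
        have "L (\<nu> - \<gamma>) r * k r = L (\<nu> - \<gamma>) r * L (- \<nu>) r * A (\<nu> / \<alpha>) r"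
          using True by (simp add: k_def)
        also have "\<dots> = L (- \<gamma>) r * A (\<nu> / \<alpha>) r"
          by (simp add: L_add)
        finally have "r\<^sup>2 * (L (\<nu> - \<gamma>) r * k r) - \<tau>\<^sup>2 * (L (\<nu> - \<gamma>) r * k r)
            = (r\<^sup>2 - \<tau>\<^sup>2) * (L (- \<gamma>) r * A (\<nu> / \<alpha>) r)"
          by (simp add: left_diff_distrib)
        then have "\<bar>r\<^sup>2 * (L (\<nu> - \<gamma>) r * k r) - \<tau>\<^sup>2 * (L (\<nu> - \<gamma>) r * k r)\<bar>
            = \<bar>r\<^sup>2 - \<tau>\<^sup>2\<bar> * (L (- \<gamma>) r * A (\<nu> / \<alpha>) r)"
          using L_pos A_pos by (simp add: abs_mult abs_of_pos)
        also have "\<dots> \<le> (C5 * \<tau> powr (2 - 2 * \<alpha>) * \<bar>r powr (2 * \<alpha>) - \<tau> powr (2 * \<alpha>)\<bar>) *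
            (C2 * A (- \<gamma> / \<alpha>) r * A (\<nu> / \<alpha>) r)"
          using \<tau> r True C5(1) L_pos[of "- \<gamma>" r] A_pos[of "\<nu> / \<alpha>" r]
          by (intro mult_mono C5(2) mult_right_mono C2(2)) auto
        also have "\<dots> = C2 * C5 * \<tau> powr (2 - 2 * \<alpha>) * (\<bar>r powr (2 * \<alpha>) - \<tau> powr (2 * \<alpha>)\<bar> * (A (- \<gamma> / \<alpha>) r * A (\<nu> / \<alpha>) r))"
          by (simp add: mult_ac)
        also have "A (- \<gamma> / \<alpha>) r * A (\<nu> / \<alpha>) r = A ((\<nu> - \<gamma>) / \<alpha>) r"
          by (simp add: A_add diff_divide_distrib)
        finally show ?thesis by (simp add: \<phi>_abs)
      next
        case False
        then show ?thesis using C2(1) C5(1) by (simp add: k_def)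
      qed
    qed
    \<comment> \<open>\<open>Lam E \<nu>\<close> cancels the factor \<open>L (- \<nu>)\<close>
      exactly, so \<open>Lam E \<nu> v\<close> is the low-frequency part of \<open>q\<close> and
      \<open>d\<close> is what remains above the cut.\<close>
    define d where "d = q - Lam E \<nu> v"
    define \<psi> where "\<psi> r = A (\<nu> / \<alpha>) r - L \<nu> r * k r" for r
    have d: "hsi \<psi> u d"
      unfolding d_def \<psi>_def[abs_def] by (rule hsi_diff[OF q Lv])
    have \<psi>: "\<psi> r = indicator {2 * \<tau><..} r * A (\<nu> / \<alpha>) r" for r
    proof -
      have "L \<nu> r * (L (- \<nu>) r * A (\<nu> / \<alpha>) r) = A (\<nu> / \<alpha>) r"
        using L_add[of \<nu> r "- \<nu>"] by (simp add: L_0 flip: mult.assoc)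
      then show ?thesis by (simp add: \<psi>_def k_def indicator_def)
    qed
    have L\<gamma>: "L \<gamma> r * A (\<nu> / \<alpha>) r \<le> C1 * A (\<gamma> / \<alpha> + \<nu> / \<alpha>) r" if "0 \<le> r" for r
      using mult_right_mono[OF C1(2)[OF that], of "A (\<nu> / \<alpha>) r"] A_pos[of "\<nu> / \<alpha>" r]
      by (simp add: A_add mult.assoc)
    have L\<gamma>_dom: "u \<in> spectral_dom E (\<lambda>r. L \<gamma> r * f r)"
      if f: "f \<in> borel_measurable borel" "\<And>r. \<bar>f r\<bar> \<le> A (\<nu> / \<alpha>) r" for f
    proof (rule dom[where B=C1])
      show "(\<lambda>r. L \<gamma> r * f r) \<in> borel_measurable borel"
        using f(1) by measurable
      fix r :: real assume r: "0 \<le> r"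
      have "\<bar>L \<gamma> r * f r\<bar> \<le> L \<gamma> r * A (\<nu> / \<alpha>) r"
        using f(2)[of r] L_pos[of \<gamma> r] by (simp add: abs_mult)
      also note L\<gamma>[OF r]
      also have "C1 * A (\<gamma> / \<alpha> + \<nu> / \<alpha>) r \<le> C1 * A p r"
        using C1(1) p(2) by (intro mult_left_mono A_mono) auto
      finally show "\<bar>L \<gamma> r * f r\<bar> \<le> C1 * A p r" .
    qed
    have in_Hs: "z \<in> Hs E \<gamma> \<longleftrightarrow> u \<in> spectral_dom E (\<lambda>r. L \<gamma> r * f r)" if "hsi f u z" for f z
      using \<gamma>(1) spectral_dom_compose[OF that L_meas] by (simp add: Hs_eq L_def[abs_def])
    have \<psi>_le: "\<bar>\<psi> r\<bar> \<le> A (\<nu> / \<alpha>) r" for r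
      using A_pos[of "\<nu> / \<alpha>" r] by (simp add: \<psi> indicator_def)
    have q_Hs: "q \<in> Hs E \<gamma>"
      unfolding in_Hs[OF q] using A_pos[of "\<nu> / \<alpha>"] by (intro L\<gamma>_dom A_meas) (simp add: abs_of_pos)
    have d_Hs: "d \<in> Hs E \<gamma>"
      unfolding in_Hs[OF d] by (intro L\<gamma>_dom hsi_measurable[OF d] \<psi>_le)
    \<comment> \<open>\<open>Q\<close> is additive only on \<open>Hs E \<gamma>\<close>, so
      splitting \<open>Q q\<close> requires both parts of \<open>q\<close> to lie there.\<close>
    have "subspace (Hs E \<gamma>)" and Q_add: "\<And>x y. \<lbrakk>x \<in> Hs E \<gamma>; y \<in> Hs E \<gamma>\<rbrakk> \<Longrightarrow> Q (x + y) = Q x + Q y"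
      using Q_lin by (auto simp: linear_op_on_def)
    then have q'_Hs: "Lam E \<nu> v \<in> Hs E \<gamma>"
      using subspace_diff[OF _ q_Hs d_Hs] by (simp add: d_def)
    have "Q q = Q (Lam E \<nu> v) + Q d"
      using Q_add[OF q'_Hs d_Hs] by (simp add: d_def)
    then have Q_le: "norm (Q (Lam E \<nu> v)) \<le> norm (Q q) + norm (Q d)"
      using norm_triangle_ineq4[of "Q q" "Q d"] by simp
    have "hsi (\<lambda>r. L \<gamma> r * \<psi> r) u (Lam E \<gamma> d)"
      unfolding Lam by (intro hsi_spectral_op_compose[OF d L_meas L_cont] L\<gamma>_dom hsi_measurable[OF d] \<psi>_le)
    \<comment> \<open>\<open>Q\<close> is bounded in the norm of \<open>Hs E \<gamma>\<close> only.
      The factor \<open>L \<gamma>\<close> raises the weight of \<open>\<psi>\<close> to the one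
      estimated in \<open>high\<close>.\<close>
    then have "norm (Lam E \<gamma> d) \<le> C1 * C6 * \<tau> powr (4 * \<gamma> - 2 * \<alpha>) * norm R"
    proof (rule hsi_norm_le[OF _ R])
      show "0 \<le> C1 * C6 * \<tau> powr (4 * \<gamma> - 2 * \<alpha>)"
        using C1(1) C6(1) by simp
      fix r :: real assume r: "0 \<le> r"
      show "\<bar>L \<gamma> r * \<psi> r\<bar> \<le> C1 * C6 * \<tau> powr (4 * \<gamma> - 2 * \<alpha>) * \<bar>\<phi> r\<bar>"
      proof (cases "r \<le> 2 * \<tau>")
        case False
        then have "\<bar>L \<gamma> r * \<psi> r\<bar> = L \<gamma> r * A (\<nu> / \<alpha>) r"
          using L_pos A_pos by (simp add: \<psi> abs_mult abs_of_pos)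
        also note L\<gamma>[OF r]
        also have "C1 * A (\<gamma> / \<alpha> + \<nu> / \<alpha>) r \<le> C1 * (C6 * \<tau> powr (4 * \<gamma> - 2 * \<alpha>) * \<bar>\<phi> r\<bar>)"
          using False C1(1) by (intro mult_left_mono high) auto
        finally show ?thesis by (simp add: mult_ac)
      qed (use C1(1) C6(1) in \<open>simp add: \<psi>\<close>)
    qed
    then have B2: "norm (Q d) \<le> K * (C1 * C6 * \<tau> powr (4 * \<gamma> - 2 * \<alpha>) * norm R)"
      using Q_bdd[OF d_Hs] K by (meson mult_left_mono order_trans)
    have E_u: "hsi (\<lambda>r. indicator {..2 * \<tau>} r * 1) u (E (2 * \<tau>) u)"
      by (rule hsi_cut[OF hsi_one])
    have B3: "norm (u - E (2 * \<tau>) u) \<le> C6 * \<tau> powr (4 * \<gamma> - 2 * \<alpha>) * norm R"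
    proof (rule hsi_norm_le[OF hsi_diff[OF hsi_one E_u] R])
      show "0 \<le> C6 * \<tau> powr (4 * \<gamma> - 2 * \<alpha>)"
        using C6(1) by simp
      fix r :: real
      show "\<bar>1 - indicator {..2 * \<tau>} r * 1\<bar> \<le> C6 * \<tau> powr (4 * \<gamma> - 2 * \<alpha>) * \<bar>\<phi> r\<bar>"
      proof (cases "r \<le> 2 * \<tau>")
        case False
        \<comment> \<open>The exponent is nonnegative, so \<open>high\<close> also serves for the
          high frequencies of \<open>u\<close> itself. This contribution carries no factor
          \<open>m\<close>, whence the \<open>m + 1\<close> in the conclusion.\<close>
        have "1 \<le> A (\<gamma> / \<alpha> + \<nu> / \<alpha>) r"
          using A_mono[of 0 "\<gamma> / \<alpha> + \<nu> / \<alpha>" r] p(6) by (simp add: A_0)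
        also have "\<dots> \<le> C6 * \<tau> powr (4 * \<gamma> - 2 * \<alpha>) * \<bar>\<phi> r\<bar>"
          using False by (intro high) auto
        finally show ?thesis using False by simp
      qed (use C6(1) in simp)
    qed
    have B4: "norm (E (2 * \<tau>) u) \<le> C3 * norm v"
    proof (rule hsi_norm_le[OF E_u v])
      fix r :: real assume "0 \<le> r"
      from h_le(2)[OF this] show "\<bar>indicator {..2 * \<tau>} r * 1\<bar> \<le> C3 * \<bar>k r\<bar>"
        using L_pos[of "- \<nu>" r] A_pos[of "\<nu> / \<alpha>" r] by (simp add: k_def indicator_def abs_mult abs_of_pos)
    qed (use C3(1) in simp)
    define n where "n = Lam_pow E \<alpha> (- N / \<alpha>) u"
    have n: "hsi (A (- N / \<alpha>)) u n"
      unfolding n_def using p by (intro A_hsi)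
    have B5: "norm (Lam E (- N) v) \<le> C4 * C3 * norm n"
    proof (rule hsi_norm_le[OF Lv n])
      fix r :: real assume r: "0 \<le> r"
      have k: "0 \<le> k r" "k r \<le> C3"
        using h_le(1)[OF r] L_pos[of "- \<nu>" r] A_pos[of "\<nu> / \<alpha>" r] C3(1) by (auto simp: k_def indicator_def)
      have "L (- N) r * k r \<le> C4 * A (- N / \<alpha>) r * C3"
        using C4(1) A_pos[of "- N / \<alpha>" r] by (intro mult_mono C4(2) r k) auto
      then show "\<bar>L (- N) r * k r\<bar> \<le> C4 * C3 * \<bar>A (- N / \<alpha>) r\<bar>"
        using k L_pos[of "- N" r] A_pos[of "- N / \<alpha>" r] by (simp add: abs_mult mult_ac)
    qed (use C3(1) C4(1) in simp)
    define T1 where "T1 = \<tau> powr (2 - 2 * \<alpha>) * norm R"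
    define T2 where "T2 = \<tau> powr (4 * \<gamma> - 2 * \<alpha>) * norm R"
    have T: "0 \<le> T1" "0 \<le> T2"
      by (auto simp: T1_def T2_def)
    have "norm u \<le> norm (E (2 * \<tau>) u) + norm (u - E (2 * \<tau>) u)"
      using norm_triangle_ineq[of "E (2 * \<tau>) u" "u - E (2 * \<tau>) u"] by simp
    also have "\<dots> \<le> C3 * norm v + C6 * T2"
      using B3 B4 by (simp add: T2_def mult.assoc)
    finally have u_le: "norm u \<le> C3 * norm v + C6 * T2" .
    have "norm v \<le> M * (C2 * C5 * T1) + m * (norm (Q q) + K * (C1 * C6 * T2)) + e * (C4 * C3 * norm n)"
    proof -
      note est[OF v_Hs Lv_dom]
      also have "M * norm (spectral_op E (\<lambda>r. r\<^sup>2) (Lam E (\<nu> - \<gamma>) v) - \<tau>\<^sup>2 *\<^sub>R Lam E (\<nu> - \<gamma>) v)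
          + m * norm (Q (Lam E \<nu> v)) + e * norm (Lam E (- N) v) \<le>
          M * (C2 * C5 * T1) + m * (norm (Q q) + K * (C1 * C6 * T2)) + e * (C4 * C3 * norm n)"
        using B1 B2 Q_le B5 nonneg
        by (intro add_mono mult_left_mono) (auto simp: a_def T1_def T2_def mult.assoc)
      finally show ?thesis .
    qed
    then have "C3 * norm v + C6 * T2 \<le>
        C3 * (M * (C2 * C5 * T1) + m * (norm (Q q) + K * (C1 * C6 * T2)) + e * (C4 * C3 * norm n)) + C6 * T2"
      using C3(1) by simp
    also have "\<dots> = (C3 * C2 * C5) * (M * T1) + (C3 * K * C1 * C6) * (m * T2) + C6 * T2
        + C3 * (m * norm (Q q)) + (C3 * C4 * C3) * (e * norm n)"
      by (simp add: algebra_simps)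
    also have "\<dots> \<le> C * (M * T1) + C * (m * T2) + C * T2 + C * (m * norm (Q q)) + C * (e * norm n)"
      using C_ge T nonneg by (intro add_mono mult_right_mono) auto
    also have "\<dots> = C * ((M * \<tau> powr (2 - 2 * \<alpha>) + (m + 1) * \<tau> powr (4 * \<gamma> - 2 * \<alpha>)) * norm R
        + m * norm (Q q) + e * norm n)"
      by (simp add: T1_def T2_def algebra_simps)
    finally have "norm u \<le> C * ((M * \<tau> powr (2 - 2 * \<alpha>) + (m + 1) * \<tau> powr (4 * \<gamma> - 2 * \<alpha>)) * norm R
        + m * norm (Q q) + e * norm n)"
      using u_le by (rule order_trans[rotated])
    then show "norm u \<le> C * ((M * \<tau> powr (2 - 2 * \<alpha>) + (m + 1) * \<tau> powr (4 * \<gamma> - 2 * \<alpha>)) *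
          norm (P_pow E \<alpha> (Lam_pow E \<alpha> ((\<nu> - \<gamma>) / \<alpha>) u) - \<tau> powr (2 * \<alpha>) *\<^sub>R Lam_pow E \<alpha> ((\<nu> - \<gamma>) / \<alpha>) u)
        + m * norm (Q (Lam_pow E \<alpha> (\<nu> / \<alpha>) u)) + e * norm (Lam_pow E \<alpha> (- N / \<alpha>) u))"
      by (simp add: R_def w_def q_def n_def)
  qed
qed

text \<open>Comparable weights give the same space with equivalent norms, so only the bound for
  \<open>Q\<close> changes.\<close>

lemma bounded_op_on_Hs_pow:
  assumes a: "0 < a" and s: "0 \<le> s" and Q: "bounded_op_on (Hs E s) (\<lambda>u. norm (Lam E s u)) Q"
  shows "bounded_op_on (Hs_pow E a (s / a)) (\<lambda>u. norm (Lam_pow E a (s / a) u)) Q"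
proof -
  let ?L = "\<lambda>r::real. (1 + r\<^sup>2) powr s" and ?A = "\<lambda>r. (1 + r powr (2 * a)) powr (s / a)"
  obtain C where C: "0 < C" "\<And>r. 0 \<le> r \<Longrightarrow> ?L r \<le> C * ?A r" "\<And>r. 0 \<le> r \<Longrightarrow> ?A r \<le> C * ?L r"
    using bracket_comparable[OF a, of s] by metis
  have meas: "?L \<in> borel_measurable borel" "?A \<in> borel_measurable borel"
    by measurable
  have cont: "continuous_on {0..} ?L" "continuous_on {0..} ?A"
    using a by (auto intro!: continuous_on_bracket continuous_on_bracket_powr)
  have Hs: "Hs E s = spectral_dom E ?L" "Hs_pow E a (s / a) = spectral_dom E ?A"
    using a s by (simp_all add: Hs_eq Hs_pow_eq)
  have eq: "Hs_pow E a (s / a) = Hs E s"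
    unfolding Hs
  proof (intro equalityI subsetI)
    fix u assume "u \<in> spectral_dom E ?A"
    then show "u \<in> spectral_dom E ?L"
      by (rule spectral_dom_bound[OF _ meas(1), where C=C]) (use C(2) in auto)
  next
    fix u assume "u \<in> spectral_dom E ?L"
    then show "u \<in> spectral_dom E ?A"
      by (rule spectral_dom_bound[OF _ meas(2), where C=C]) (use C(3) in auto)
  qed
  obtain K where K: "\<And>u. u \<in> Hs E s \<Longrightarrow> norm (Q u) \<le> K * norm (Lam E s u)"
    using Q by (auto simp: bounded_op_on_def)
  \<comment> \<open>The constant in \<open>bounded_op_on\<close> may be negative; its absolute value
    allows the norm beside it to be enlarged.\<close>
  have "norm (Q u) \<le> \<bar>K\<bar> * C * norm (Lam_pow E a (s / a) u)" if u: "u \<in> Hs E s" for u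
  proof -
    have "norm (Lam E s u) \<le> C * norm (Lam_pow E a (s / a) u)"
      unfolding Lam_def Lam_pow_def
    proof (rule hsi_norm_le[where f="?L" and g="?A"])
      show "hsi ?L u (spectral_op E ?L u)"
        using u by (intro hsi_spectral_op meas cont) (simp only: Hs)
      show "hsi ?A u (spectral_op E ?A u)"
        using u by (intro hsi_spectral_op meas cont) (simp only: flip: Hs(2), simp only: eq)
    qed (use C in auto)
    have "norm (Q u) \<le> \<bar>K\<bar> * norm (Lam E s u)"
      using K[OF u] mult_right_mono[OF abs_ge_self, of "norm (Lam E s u)" K] by simp
    also have "\<dots> \<le> \<bar>K\<bar> * (C * norm (Lam_pow E a (s / a) u))"
      by (intro mult_left_mono \<open>norm (Lam E s u) \<le> _\<close>) simp
    finally show ?thesis by (simp add: mult.assoc)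
  qed
  then show ?thesis
    using Q unfolding bounded_op_on_def eq by blast
qed

end

section \<open>Passage from the frequency \<open>\<tau>\<close> of \<open>P\<close> to the frequency
  \<open>\<lambda>\<close> of its power\<close>

theorem theorem3:
  fixes D :: "'h::{real_inner, complete_space} set"
    and P :: "'h \<Rightarrow> 'h"
    and E :: "real \<Rightarrow> 'h \<Rightarrow> 'h"
    and Q :: "'h \<Rightarrow> 'y::{real_inner, complete_space}"
    and \<gamma> \<mu> N \<alpha> lam0 :: real
    and M m e :: "real \<Rightarrow> real"
  assumes "self_adjoint_on D P" and "nonneg_on D P" and "compact_resolvent_on D P"
    and "spectral_resolution D P E"
    and "0 \<le> \<gamma>" and "\<gamma> \<le> 1 / 2" and "0 \<le> \<mu>"
    and "bounded_op_on (Hs E \<gamma>) (\<lambda>u. norm (Lam E \<gamma> u)) Q"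
    and "continuous_on {0..} M" and "\<forall>x\<ge>0. 0 < M x" and "\<exists>c>0. \<forall>x\<ge>0. c \<le> M x"
    and "continuous_on {0..} m" and "\<forall>x\<ge>0. 0 < m x" and "\<exists>c>0. \<forall>x\<ge>0. c \<le> m x"
    and "\<forall>x\<ge>0. 0 \<le> e x"
    and "0 < N" and "0 \<le> lam0"
    and "\<forall>lam>lam0. \<forall>u \<in> Hs E (1 + \<mu> - \<gamma>).
           norm u \<le> M lam * inverse lam * norm (P (Lam E (\<mu> - \<gamma>) u) - lam\<^sup>2 *\<^sub>R Lam E (\<mu> - \<gamma>) u)
                    + m lam * norm (Q (Lam E \<mu> u))
                    + e lam * norm (Lam E (- N) u)"
    and "0 < \<alpha>" and "2 * \<gamma> \<le> \<alpha>"
  shows "bounded_op_on (Hs_pow E \<alpha> (\<gamma> / \<alpha>)) (\<lambda>u. norm (Lam_pow E \<alpha> (\<gamma> / \<alpha>) u)) Q \<and>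
         (\<exists>C>0. \<exists>lam0'>0. \<forall>lam>lam0'. \<forall>u \<in> Hs_pow E \<alpha> (1 + (\<mu> - \<gamma>) / \<alpha>).
           norm u \<le> C * (M (lam powr (1 / \<alpha>)) * lam powr (1 / \<alpha> - 1)
                          + m (lam powr (1 / \<alpha>))
                            * lam powr (1 + (- 2 + 2 * max (2 * \<gamma> + 1 - \<alpha>) 0) / \<alpha>))
                      * inverse (jap lam)
                      * norm (P_pow E \<alpha> (Lam_pow E \<alpha> ((\<mu> - \<gamma>) / \<alpha>) u)
                              - lam\<^sup>2 *\<^sub>R Lam_pow E \<alpha> ((\<mu> - \<gamma>) / \<alpha>) u)
                    + C * m (lam powr (1 / \<alpha>)) * norm (Q (Lam_pow E \<alpha> (\<mu> / \<alpha>) u))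
                    + C * e (lam powr (1 / \<alpha>)) * norm (Lam_pow E \<alpha> (- N / \<alpha>) u))"
proof -
  have E: "spectral_family E" "\<And>r u. r < 0 \<Longrightarrow> E r u = 0" "D = spectral_dom E (\<lambda>r. r\<^sup>2)"
    "\<And>u. u \<in> D \<Longrightarrow> P u = spectral_op E (\<lambda>r. r\<^sup>2) u"
    using assms(4) by (auto simp: spectral_resolution_def)
  interpret half_line_spectral_family E
    by unfold_locales (use E in auto)
  note \<alpha> = \<open>0 < \<alpha>\<close>
  obtain K0 where Q: "linear_op_on (Hs E \<gamma>) Q" "\<And>u. u \<in> Hs E \<gamma> \<Longrightarrow> norm (Q u) \<le> K0 * norm (Lam E \<gamma> u)"
    using assms(8) by (auto simp: bounded_op_on_def)
  have Q_bdd: "norm (Q u) \<le> \<bar>K0\<bar> * norm (Lam E \<gamma> u)" if "u \<in> Hs E \<gamma>" for u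
    using Q(2)[OF that] mult_right_mono[OF abs_ge_self, of "norm (Lam E \<gamma> u)" K0] by simp
  from frequency_splitting[OF \<alpha> \<open>2 * \<gamma> \<le> \<alpha>\<close> \<open>0 \<le> \<gamma>\<close> \<open>\<gamma> \<le> 1 / 2\<close> \<open>0 \<le> \<mu>\<close> \<open>0 < N\<close> abs_ge_zero Q(1) Q_bdd]
  obtain C where C: "0 < C" "\<And>\<tau> M m e u. \<lbrakk>1 \<le> \<tau>; 0 \<le> M; 0 \<le> m; 0 \<le> e; u \<in> Hs_pow E \<alpha> (1 + (\<mu> - \<gamma>) / \<alpha>);
      \<And>v. \<lbrakk>v \<in> Hs E (1 + \<mu> - \<gamma>); Lam E (\<mu> - \<gamma>) v \<in> spectral_dom E (\<lambda>r. r\<^sup>2)\<rbrakk> \<Longrightarrow>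
        norm v \<le> M * norm (spectral_op E (\<lambda>r. r\<^sup>2) (Lam E (\<mu> - \<gamma>) v) - \<tau>\<^sup>2 *\<^sub>R Lam E (\<mu> - \<gamma>) v)
          + m * norm (Q (Lam E \<mu> v)) + e * norm (Lam E (- N) v)\<rbrakk> \<Longrightarrow>
      norm u \<le> C * ((M * \<tau> powr (2 - 2 * \<alpha>) + (m + 1) * \<tau> powr (4 * \<gamma> - 2 * \<alpha>)) *
          norm (P_pow E \<alpha> (Lam_pow E \<alpha> ((\<mu> - \<gamma>) / \<alpha>) u) - \<tau> powr (2 * \<alpha>) *\<^sub>R Lam_pow E \<alpha> ((\<mu> - \<gamma>) / \<alpha>) u)
        + m * norm (Q (Lam_pow E \<alpha> (\<mu> / \<alpha>) u)) + e * norm (Lam_pow E \<alpha> (- N / \<alpha>) u))"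
    by metis
  obtain c where c: "0 < c" "\<And>x. 0 \<le> x \<Longrightarrow> c \<le> m x"
    using assms(14) by blast
  \<comment> \<open>The 2 comes from \<open>inverse lam \<le> 2 * inverse (jap lam)\<close>, the
    factor \<open>1 + 1 / c\<close> from absorbing \<open>m \<tau> + 1\<close> into a multiple of
    \<open>m \<tau>\<close>.\<close>
  define C' where "C' = 2 * C * (1 + 1 / c)"
  have C': "0 < C'" "C \<le> C'"
    using C(1) c(1) by (auto simp: C'_def field_simps intro: add_pos_pos)
  \<comment> \<open>\<open>lam0 powr \<alpha>\<close> ensures \<open>lam0 < \<tau>\<close>; the 1
    ensures \<open>1 \<le> \<tau>\<close> for the elliptic bound and makes \<open>jap lam\<close> at
    most \<open>2 * lam\<close>.\<close>
  define lam0' where "lam0' = max 1 (lam0 powr \<alpha>)"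
  have "norm u \<le> C' * (M (lam powr (1 / \<alpha>)) * lam powr (1 / \<alpha> - 1)
                          + m (lam powr (1 / \<alpha>))
                            * lam powr (1 + (- 2 + 2 * max (2 * \<gamma> + 1 - \<alpha>) 0) / \<alpha>))
                      * inverse (jap lam)
                      * norm (P_pow E \<alpha> (Lam_pow E \<alpha> ((\<mu> - \<gamma>) / \<alpha>) u)
                              - lam\<^sup>2 *\<^sub>R Lam_pow E \<alpha> ((\<mu> - \<gamma>) / \<alpha>) u)
                    + C' * m (lam powr (1 / \<alpha>)) * norm (Q (Lam_pow E \<alpha> (\<mu> / \<alpha>) u))
                    + C' * e (lam powr (1 / \<alpha>)) * norm (Lam_pow E \<alpha> (- N / \<alpha>) u)"
    if lam: "lam0' < lam" and u: "u \<in> Hs_pow E \<alpha> (1 + (\<mu> - \<gamma>) / \<alpha>)" for lam u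
  proof -
    have lam1: "1 < lam" "lam0 powr \<alpha> < lam"
      using lam by (auto simp: lam0'_def)
    define \<tau> where "\<tau> = lam powr (1 / \<alpha>)"
    have \<tau>1: "1 \<le> \<tau>"
      unfolding \<tau>_def using lam1 \<alpha> by (intro ge_one_powr_ge_zero) auto
    have "(lam0 powr \<alpha>) powr (1 / \<alpha>) < lam powr (1 / \<alpha>)"
      using lam1 \<alpha> by (intro powr_less_mono2) auto
    then have \<tau>0: "lam0 < \<tau>"
      using \<alpha> \<open>0 \<le> lam0\<close> by (simp add: \<tau>_def powr_powr)
    have \<tau>_pow: "\<tau> powr (2 * \<alpha>) = lam\<^sup>2"
      using \<alpha> lam1 by (simp add: \<tau>_def powr_powr)
    have M: "0 \<le> M \<tau> * inverse \<tau>" and m: "0 \<le> m \<tau>" and e: "0 \<le> e \<tau>"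
      using assms(10,13,15) \<tau>1 by (auto simp: less_imp_le)
    define X where "X = norm (P_pow E \<alpha> (Lam_pow E \<alpha> ((\<mu> - \<gamma>) / \<alpha>) u) - lam\<^sup>2 *\<^sub>R Lam_pow E \<alpha> ((\<mu> - \<gamma>) / \<alpha>) u)"
    define q where "q = norm (Q (Lam_pow E \<alpha> (\<mu> / \<alpha>) u))"
    define n where "n = norm (Lam_pow E \<alpha> (- N / \<alpha>) u)"
    have nonneg: "0 \<le> X" "0 \<le> q" "0 \<le> n"
      by (auto simp: X_def q_def n_def)
    have main: "norm u \<le> C * ((M \<tau> * inverse \<tau> * \<tau> powr (2 - 2 * \<alpha>) + (m \<tau> + 1) * \<tau> powr (4 * \<gamma> - 2 * \<alpha>)) * X
        + m \<tau> * q + e \<tau> * n)"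
      unfolding X_def q_def n_def \<tau>_pow[symmetric]
    proof (rule C(2)[OF \<tau>1 M m e u])
      \<comment> \<open>The second property places \<open>Lam E (\<mu> - \<gamma>) v\<close> in
        \<open>D\<close>, where \<open>P\<close> equals the spectral integral.\<close>
      fix v assume "v \<in> Hs E (1 + \<mu> - \<gamma>)" "Lam E (\<mu> - \<gamma>) v \<in> spectral_dom E (\<lambda>r. r\<^sup>2)"
      then show "norm v \<le> M \<tau> * inverse \<tau> * norm (spectral_op E (\<lambda>r. r\<^sup>2) (Lam E (\<mu> - \<gamma>) v) - \<tau>\<^sup>2 *\<^sub>R Lam E (\<mu> - \<gamma>) v)
          + m \<tau> * norm (Q (Lam E \<mu> v)) + e \<tau> * norm (Lam E (- N) v)"
        using assms(18) \<tau>0 E(3,4) by metis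
    qed
    define x where "x = lam powr (1 / \<alpha> - 1)"
    define y where "y = lam powr (1 + (- 2 + 2 * max (2 * \<gamma> + 1 - \<alpha>) 0) / \<alpha>)"
    \<comment> \<open>In terms of \<open>lam\<close> this is
      \<open>lam powr (1 / \<alpha> - 2)\<close>; one \<open>inverse lam\<close> is split off to
      become the Japanese bracket.\<close>
    have "inverse \<tau> * \<tau> powr (2 - 2 * \<alpha>) = \<tau> powr (1 - 2 * \<alpha>)"
      using \<tau>1 powr_add[of \<tau> "-1" "2 - 2 * \<alpha>"] by (simp add: powr_minus)
    also have "\<dots> = lam powr (1 / \<alpha> - 1 + - 1)"
      using \<alpha> by (simp add: \<tau>_def powr_powr field_simps)
    also have "\<dots> = x * inverse lam"
      using lam1 unfolding x_def powr_add by (simp add: powr_minus)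
    finally have x: "inverse \<tau> * \<tau> powr (2 - 2 * \<alpha>) = x * inverse lam" .
    have "\<tau> powr (4 * \<gamma> - 2 * \<alpha>) \<le> \<tau> powr (- 2 + 2 * max (2 * \<gamma> + 1 - \<alpha>) 0)"
      using \<tau>1 by (intro powr_mono) (auto simp: max_def)
    also have "\<dots> = lam powr ((1 + (- 2 + 2 * max (2 * \<gamma> + 1 - \<alpha>) 0) / \<alpha>) + - 1)"
      by (simp add: \<tau>_def powr_powr)
    also have "\<dots> = y * inverse lam"
      using lam1 unfolding y_def powr_add by (simp add: powr_minus)
    finally have y: "\<tau> powr (4 * \<gamma> - 2 * \<alpha>) \<le> y * inverse lam" .
    have xy: "0 \<le> x" "0 \<le> y"
      by (auto simp: x_def y_def)
    have "1 \<le> lam\<^sup>2" "(2 * lam)\<^sup>2 = 4 * lam\<^sup>2"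
      using lam1 by (simp_all add: power_mult_distrib)
    then have "1 + lam\<^sup>2 \<le> (2 * lam)\<^sup>2"
      by linarith
    then have "jap lam \<le> 2 * lam"
      unfolding jap_def using lam1 by (intro real_le_lsqrt) auto
    moreover have "0 < jap lam"
      by (simp add: jap_def add_pos_nonneg)
    ultimately have jap: "inverse lam \<le> 2 * inverse (jap lam)"
      using lam1 by (simp add: field_simps)
    have M0: "0 \<le> M \<tau>"
      using assms(10) \<tau>1 by (simp add: less_imp_le)
    have m1: "m \<tau> + 1 \<le> (1 + 1 / c) * m \<tau>"
      using c(1) c(2)[of \<tau>] \<tau>1 by (simp add: field_simps)
    have "M \<tau> * inverse \<tau> * \<tau> powr (2 - 2 * \<alpha>) + (m \<tau> + 1) * \<tau> powr (4 * \<gamma> - 2 * \<alpha>)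
        \<le> (1 + 1 / c) * M \<tau> * (x * inverse lam) + (1 + 1 / c) * m \<tau> * (y * inverse lam)"
    proof (rule add_mono)
      have "1 * (M \<tau> * (x * inverse lam)) \<le> (1 + 1 / c) * (M \<tau> * (x * inverse lam))"
        using c(1) M0 xy lam1 by (intro mult_right_mono) auto
      then show "M \<tau> * inverse \<tau> * \<tau> powr (2 - 2 * \<alpha>) \<le> (1 + 1 / c) * M \<tau> * (x * inverse lam)"
        by (simp add: mult.assoc x)
      show "(m \<tau> + 1) * \<tau> powr (4 * \<gamma> - 2 * \<alpha>) \<le> (1 + 1 / c) * m \<tau> * (y * inverse lam)"
        using m c(1) by (intro mult_mono m1 y) auto
    qed
    also have "\<dots> = (1 + 1 / c) * (M \<tau> * x + m \<tau> * y) * inverse lam"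
      by (simp add: algebra_simps)
    also have "\<dots> \<le> (1 + 1 / c) * (M \<tau> * x + m \<tau> * y) * (2 * inverse (jap lam))"
      using c(1) M0 m xy by (intro mult_left_mono jap) auto
    finally have "(M \<tau> * inverse \<tau> * \<tau> powr (2 - 2 * \<alpha>) + (m \<tau> + 1) * \<tau> powr (4 * \<gamma> - 2 * \<alpha>)) * X
        \<le> (1 + 1 / c) * (M \<tau> * x + m \<tau> * y) * (2 * inverse (jap lam)) * X"
      using nonneg(1) by (rule mult_right_mono)
    then have "C * ((M \<tau> * inverse \<tau> * \<tau> powr (2 - 2 * \<alpha>) + (m \<tau> + 1) * \<tau> powr (4 * \<gamma> - 2 * \<alpha>)) * X
        + m \<tau> * q + e \<tau> * n) \<le> C * ((1 + 1 / c) * (M \<tau> * x + m \<tau> * y) * (2 * inverse (jap lam)) * X + m \<tau> * q + e \<tau> * n)"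
      using C(1) by simp
    also have "\<dots> = C' * (M \<tau> * x + m \<tau> * y) * inverse (jap lam) * X + C * (m \<tau> * q) + C * (e \<tau> * n)"
      by (simp add: C'_def algebra_simps)
    also have "\<dots> \<le> C' * (M \<tau> * x + m \<tau> * y) * inverse (jap lam) * X + C' * (m \<tau> * q) + C' * (e \<tau> * n)"
      using C'(2) m e nonneg by (intro add_mono order_refl mult_right_mono) auto
    finally show ?thesis
      using main by (simp add: X_def q_def n_def x_def y_def \<tau>_def mult.assoc)
  qed
  moreover have "0 < lam0'"
    by (simp add: lam0'_def)
  ultimately have "\<exists>C>0. \<exists>lam0'>0. \<forall>lam>lam0'. \<forall>u \<in> Hs_pow E \<alpha> (1 + (\<mu> - \<gamma>) / \<alpha>).
           norm u \<le> C * (M (lam powr (1 / \<alpha>)) * lam powr (1 / \<alpha> - 1)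
                          + m (lam powr (1 / \<alpha>))
                            * lam powr (1 + (- 2 + 2 * max (2 * \<gamma> + 1 - \<alpha>) 0) / \<alpha>))
                      * inverse (jap lam)
                      * norm (P_pow E \<alpha> (Lam_pow E \<alpha> ((\<mu> - \<gamma>) / \<alpha>) u)
                              - lam\<^sup>2 *\<^sub>R Lam_pow E \<alpha> ((\<mu> - \<gamma>) / \<alpha>) u)
                    + C * m (lam powr (1 / \<alpha>)) * norm (Q (Lam_pow E \<alpha> (\<mu> / \<alpha>) u))
                    + C * e (lam powr (1 / \<alpha>)) * norm (Lam_pow E \<alpha> (- N / \<alpha>) u)"
    using C'(1) by blast
  with bounded_op_on_Hs_pow[OF \<alpha> \<open>0 \<le> \<gamma>\<close> assms(8)] show ?thesis by blast
qed

end
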